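(* Let $\delta$ be a matrix of free polynomials in $d$ variables with $\delta(0)=0$. The Cayley transforms $f\leftrightarrow h$ between $\mathcal{RSA}(B_\delta)$ and $\mathrm{RHA}(B_\delta)$ defined by $$h(x):=(I+f(x))(I-f(x))^{-1}\quad(f\in\mathcal{RSA}(B_\delta)),\qquad f(x):=(h(x)-I)(h(x)+I)^{-1}\quad(h\in\mathrm{RHA}(B_\delta))$$ for $x\in B_\delta$ are homeomorphisms, where both classes carry the topology of uniform convergence on the sets $K_{\delta,r}$, $0<r<1$.
   Context: Let $\mathbb{M}_n$ be the $n\times n$ complex matrices (with operator norm), $\mathbb{M}_n^d$ the $d$-tuples of $n\times n$ complex matrices, $\mathbb{M}^d=\coprod_{n\ge1}\mathbb{M}_n^d$ and $\mathbb{M}=\mathbb{M}^1$. A free polynomial in $d$ variables is an element of $\mathbb{C}\langle x_1,\dots,x_d\rangle$; it is evaluated on $x\in\mathbb{M}_n^d$ in the usual way to give an element of $\mathbb{M}_n$. If $\delta$ is an $s\times r$ matrix of free polynomials and $x\in\mathbb{M}_n^d$, then $\delta(x)$ is the $s\times r$ block matrix with $n\times n$ blocks obtained by entrywise evaluation, and $\|\delta(x)\|$ is its operator norm. Define $B_\delta=\{x\in\mathbb{M}^d: \|\delta(x)\|<1\}$ and, for $0<r<1$, $K_{\delta,r}=\{x\in B_\delta:\|\delta(x)\|\le r\}$. Here $0$ denotes the zero tuple in any $\mathbb{M}_n^d$. For $\Omega\subset\mathbb{M}^d$ closed under direct sums, with $\Omega_n=\Omega\cap\mathbb{M}_n^d$,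 a function $f:\Omega\to\mathbb{M}$ is an nc function if it is graded ($f(x)\in\mathbb{M}_n$ whenever $x\in\Omega_n$) and, whenever $x\in\Omega_n$, $y\in\Omega_m$ and an $m\times n$ matrix $\alpha$ satisfy $\alpha x=y\alpha$ (componentwise), then $\alpha f(x)=f(y)\alpha$. The regular nc Schur-Agler class $\mathcal{RSA}(B_\delta)$ is the set of nc functions $f:B_\delta\to\mathbb{M}$ with $\sup_{x\in B_\delta}\|f(x)\|\le1$ and $f(0)=0$. The regular free Herglotz-Agler class $\mathrm{RHA}(B_\delta)$ is the set of nc functions $h:B_\delta\to\mathbb{M}$ with $\Re h(x)=\frac{h(x)+h(x)^*}{2}\ge0$ for all $x\in B_\delta$ and $h(0)=I$. In the topology on both classes, a net $\{f_\lambda\}$ converges to $f$ if and only if for every $0<r<1$ it converges to $f$ uniformly in operator norm on $K_{\delta,r}$. *)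

theory Defs
  imports
    "HOL-Library.Poly_Mapping"
    "HOL-Analysis.L2_Norm"
    "HOL-Analysis.Abstract_Limits"
    "Jordan_Normal_Form.Schur_Decomposition"
begin

section \<open>Norms, positivity and inverses of complex matrices\<close>

definition l2_norm :: "complex vec \<Rightarrow> real" where
  "l2_norm v = L2_set (\<lambda>i. cmod (v $ i)) {..<dim_vec v}"

definition opnorm :: "complex mat \<Rightarrow> real" where
  "opnorm A = (SUP v \<in> {v \<in> carrier_vec (dim_col A). l2_norm v \<le> 1}. l2_norm (A *\<^sub>v v))"

definition Re_mat :: "complex mat \<Rightarrow> complex mat" where
  "Re_mat A = (1/2) \<cdot>\<^sub>m (A + mat_adjoint A)"

text \<open>The order on \<^typ>\<open>complex\<close> makes \<open>0 \<le> z\<close> mean that \<open>z\<close> is real and nonnegative;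
  \<open>u \<bullet>c v\<close> is the inner product, conjugate linear in \<open>v\<close>.\<close>

definition psd_mat :: "complex mat \<Rightarrow> bool" where
  "psd_mat A \<longleftrightarrow> square_mat A \<and> (\<forall>v \<in> carrier_vec (dim_row A). 0 \<le> (A *\<^sub>v v) \<bullet>c v)"

text \<open>Only meaningful if \<open>A\<close> is invertible.\<close>

definition mat_inv :: "complex mat \<Rightarrow> complex mat" where
  "mat_inv A = the (mat_inverse A)"


section \<open>Free polynomials and the nc space\<close>

text \<open>An element of the free algebra is a finitely supported family of complex coefficients
  indexed by words; the letter \<open>i\<close> stands for the variable with (zero-based) index \<open>i\<close>.\<close>

type_synonym free_poly = "nat list \<Rightarrow>\<^sub>0 complex"

definition free_polys :: "nat \<Rightarrow> free_poly set" where
  "free_polys d = {p. Poly_Mapping.keys p \<subseteq> lists {..<d}}"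

text \<open>A point \<open>(n, x)\<close> of the disjoint union carries its size \<open>n\<close> explicitly.\<close>

type_synonym nc_point = "nat \<times> complex mat list"

definition mat_tuples :: "nat \<Rightarrow> nat \<Rightarrow> complex mat list set" where
  "mat_tuples d n = {x. length x = d \<and> set x \<subseteq> carrier_mat n n}"

definition nc_space :: "nat \<Rightarrow> nc_point set" where
  "nc_space d = Sigma {1..} (mat_tuples d)"

definition zero_point :: "nat \<Rightarrow> nat \<Rightarrow> nc_point" where
  "zero_point d n = (n, replicate d (0\<^sub>m n n))"

definition word_eval :: "nat list \<Rightarrow> nc_point \<Rightarrow> complex mat" where
  "word_eval w x = foldr (\<lambda>i A. snd x ! i * A) w (1\<^sub>m (fst x))"

text \<open>The linear combination of the words is written entrywise, because matrices of unspecified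
  size have no zero element to sum from.\<close>

definition free_poly_eval :: "free_poly \<Rightarrow> nc_point \<Rightarrow> complex mat" where
  "free_poly_eval p x = mat (fst x) (fst x)
     (\<lambda>ij. \<Sum>w \<in> Poly_Mapping.keys p. Poly_Mapping.lookup p w * word_eval w x $$ ij)"

text \<open>Block matrix whose \<open>(k, l)\<close> block is the value of the \<open>(k, l)\<close> entry of \<open>\<delta>\<close>.\<close>

definition free_mat_eval :: "free_poly mat \<Rightarrow> nc_point \<Rightarrow> complex mat" where
  "free_mat_eval \<delta> x = (let n = fst x in
     mat (dim_row \<delta> * n) (dim_col \<delta> * n)
       (\<lambda>(i, j). free_poly_eval (\<delta> $$ (i div n, j div n)) x $$ (i mod n, j mod n)))"

definition B_set :: "nat \<Rightarrow> free_poly mat \<Rightarrow> nc_point set" where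
  "B_set d \<delta> = {x \<in> nc_space d. opnorm (free_mat_eval \<delta> x) < 1}"

definition K_set :: "nat \<Rightarrow> free_poly mat \<Rightarrow> real \<Rightarrow> nc_point set" where
  "K_set d \<delta> \<rho> = {x \<in> B_set d \<delta>. opnorm (free_mat_eval \<delta> x) \<le> \<rho>}"


section \<open>Nc functions and the two classes\<close>

text \<open>Functions with domain \<open>\<Omega>\<close> are HOL functions that are \<^const>\<open>undefined\<close> outside \<open>\<Omega>\<close>, so that
  two of them are equal iff they agree on \<open>\<Omega>\<close>.\<close>

definition nc_function :: "nat \<Rightarrow> nc_point set \<Rightarrow> (nc_point \<Rightarrow> complex mat) \<Rightarrow> bool" where
  "nc_function d \<Omega> f \<longleftrightarrow>
     f \<in> (\<Pi>\<^sub>E x \<in> \<Omega>. carrier_mat (fst x) (fst x)) \<and>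
     (\<forall>x \<in> \<Omega>. \<forall>y \<in> \<Omega>. \<forall>\<alpha> \<in> carrier_mat (fst y) (fst x).
        (\<forall>i < d. \<alpha> * snd x ! i = snd y ! i * \<alpha>) \<longrightarrow> \<alpha> * f x = f y * \<alpha>)"

definition RSA :: "nat \<Rightarrow> free_poly mat \<Rightarrow> (nc_point \<Rightarrow> complex mat) set" where
  "RSA d \<delta> = {f. nc_function d (B_set d \<delta>) f \<and>
     (\<forall>x \<in> B_set d \<delta>. opnorm (f x) \<le> 1) \<and>
     (\<forall>n \<ge> 1. f (zero_point d n) = 0\<^sub>m n n)}"

definition RHA :: "nat \<Rightarrow> free_poly mat \<Rightarrow> (nc_point \<Rightarrow> complex mat) set" where
  "RHA d \<delta> = {h. nc_function d (B_set d \<delta>) h \<and>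
     (\<forall>x \<in> B_set d \<delta>. psd_mat (Re_mat (h x))) \<and>
     (\<forall>n \<ge> 1. h (zero_point d n) = 1\<^sub>m n)}"


section \<open>The topology of uniform convergence on the sets \<open>K_set d \<delta> \<rho>\<close>\<close>

text \<open>Since the sets \<open>K_set d \<delta> \<rho>\<close> increase with \<open>\<rho>\<close>, a single \<open>\<rho>\<close> suffices for a basic
  neighbourhood.\<close>

definition unif_open ::
  "nat \<Rightarrow> free_poly mat \<Rightarrow> (nc_point \<Rightarrow> complex mat) set \<Rightarrow> (nc_point \<Rightarrow> complex mat) set \<Rightarrow> bool"
where
  "unif_open d \<delta> C U \<longleftrightarrow> U \<subseteq> C \<and>
     (\<forall>f \<in> U. \<exists>\<rho>. 0 < \<rho> \<and> \<rho> < 1 \<and> (\<exists>\<epsilon> > 0.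
        {g \<in> C. \<forall>x \<in> K_set d \<delta> \<rho>. opnorm (g x - f x) < \<epsilon>} \<subseteq> U))"

definition unif_topology ::
  "nat \<Rightarrow> free_poly mat \<Rightarrow> (nc_point \<Rightarrow> complex mat) set \<Rightarrow> (nc_point \<Rightarrow> complex mat) topology"
where
  "unif_topology d \<delta> C = topology (unif_open d \<delta> C)"

lemma K_set_mono: "\<rho> \<le> \<sigma> \<Longrightarrow> K_set d \<delta> \<rho> \<subseteq> K_set d \<delta> \<sigma>"
  by (auto simp: K_set_def)

lemma istopology_unif_open: "istopology (unif_open d \<delta> C)"
  unfolding istopology_def
proof (intro conjI allI impI)
  fix S T assume S: "unif_open d \<delta> C S" and T: "unif_open d \<delta> C T"
  show "unif_open d \<delta> C (S \<inter> T)"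
    unfolding unif_open_def
  proof (intro conjI ballI)
    show "S \<inter> T \<subseteq> C" using S by (auto simp: unif_open_def)
    fix f assume f: "f \<in> S \<inter> T"
    obtain \<rho> \<epsilon> where 1: "0 < \<rho>" "\<rho> < 1" "\<epsilon> > 0"
      "{g \<in> C. \<forall>x \<in> K_set d \<delta> \<rho>. opnorm (g x - f x) < \<epsilon>} \<subseteq> S"
      using S f unfolding unif_open_def by blast
    obtain \<sigma> \<eta> where 2: "0 < \<sigma>" "\<sigma> < 1" "\<eta> > 0"
      "{g \<in> C. \<forall>x \<in> K_set d \<delta> \<sigma>. opnorm (g x - f x) < \<eta>} \<subseteq> T"
      using T f unfolding unif_open_def by blast
    have "{g \<in> C. \<forall>x \<in> K_set d \<delta> (max \<rho> \<sigma>). opnorm (g x - f x) < min \<epsilon> \<eta>} \<subseteq> S \<inter> T"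
      using 1(4) 2(4) K_set_mono[of \<rho> "max \<rho> \<sigma>" d \<delta>] K_set_mono[of \<sigma> "max \<rho> \<sigma>" d \<delta>] by fastforce
    then show "\<exists>\<rho>. 0 < \<rho> \<and> \<rho> < 1 \<and> (\<exists>\<epsilon> > 0.
        {g \<in> C. \<forall>x \<in> K_set d \<delta> \<rho>. opnorm (g x - f x) < \<epsilon>} \<subseteq> S \<inter> T)"
      using 1 2 by (intro exI[of _ "max \<rho> \<sigma>"] conjI exI[of _ "min \<epsilon> \<eta>"]) auto
  qed
next
  fix \<K> assume K: "\<forall>K \<in> \<K>. unif_open d \<delta> C K"
  show "unif_open d \<delta> C (\<Union> \<K>)"
    unfolding unif_open_def
  proof (intro conjI ballI)
    show "\<Union> \<K> \<subseteq> C" using K by (auto simp: unif_open_def)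
    fix f assume "f \<in> \<Union> \<K>"
    then obtain S where S: "S \<in> \<K>" "f \<in> S" by auto
    then obtain \<rho> \<epsilon> where 1: "0 < \<rho>" "\<rho> < 1" "\<epsilon> > 0"
      "{g \<in> C. \<forall>x \<in> K_set d \<delta> \<rho>. opnorm (g x - f x) < \<epsilon>} \<subseteq> S"
      using K unfolding unif_open_def by blast
    then show "\<exists>\<rho>. 0 < \<rho> \<and> \<rho> < 1 \<and> (\<exists>\<epsilon> > 0.
        {g \<in> C. \<forall>x \<in> K_set d \<delta> \<rho>. opnorm (g x - f x) < \<epsilon>} \<subseteq> \<Union> \<K>)"
      using S by blast
  qed
qed

lemma openin_unif_topology: "openin (unif_topology d \<delta> C) = unif_open d \<delta> C"
  by (simp add: unif_topology_def istopology_unif_open)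

lemma topspace_unif_topology [simp]: "topspace (unif_topology d \<delta> C) = C"
proof -
  have "unif_open d \<delta> C C"
    unfolding unif_open_def
    by (intro conjI ballI exI[of _ "1/2"] exI[of _ "1"]) auto
  moreover have "S \<subseteq> C" if "unif_open d \<delta> C S" for S
    using that by (simp add: unif_open_def)
  ultimately show ?thesis
    unfolding topspace_def openin_unif_topology by blast
qed

lemma l2_norm_nonneg: "0 \<le> l2_norm v"
  by (simp add: l2_norm_def)

lemma l2_norm_add:
  assumes "u \<in> carrier_vec n" "v \<in> carrier_vec n"
  shows "l2_norm (u + v) \<le> l2_norm u + l2_norm v"
proof -
  have "l2_norm (u + v) \<le> L2_set (\<lambda>i. cmod (u $ i) + cmod (v $ i)) {..<n}"
    using assms unfolding l2_norm_def by (auto intro!: L2_set_mono norm_triangle_ineq)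
  also have "\<dots> \<le> l2_norm u + l2_norm v"
    using assms unfolding l2_norm_def by (auto intro: order_trans[OF L2_set_triangle_ineq])
  finally show ?thesis .
qed

lemma opnorm_bdd:
  "bdd_above ((\<lambda>v. l2_norm (A *\<^sub>v v)) ` {v \<in> carrier_vec (dim_col A). l2_norm v \<le> 1})"
proof (rule bdd_aboveI2)
  fix v assume "v \<in> {v \<in> carrier_vec (dim_col A). l2_norm v \<le> 1}"
  then have v: "dim_vec v = dim_col A" and v1: "l2_norm v \<le> 1" by auto
  have c: "cmod (v $ j) \<le> 1" if "j < dim_col A" for j
    using member_le_L2_set[of "{..<dim_vec v}" j "\<lambda>i. cmod (v $ i)"] v v1 that
    by (simp add: l2_norm_def)
  have "cmod ((A *\<^sub>v v) $ i) \<le> (\<Sum>j<dim_col A. cmod (A $$ (i, j)))" if "i < dim_row A" for i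
  proof -
    have "cmod ((A *\<^sub>v v) $ i) = cmod (\<Sum>j<dim_col A. A $$ (i, j) * v $ j)"
      using that v by (simp add: scalar_prod_def atLeast0LessThan)
    also have "\<dots> \<le> (\<Sum>j<dim_col A. cmod (A $$ (i, j)) * cmod (v $ j))"
      by (rule order_trans[OF norm_sum]) (simp add: norm_mult)
    also have "\<dots> \<le> (\<Sum>j<dim_col A. cmod (A $$ (i, j)))"
      by (intro sum_mono) (use c in \<open>auto intro: mult_left_le\<close>)
    finally show ?thesis .
  qed
  then show "l2_norm (A *\<^sub>v v) \<le> L2_set (\<lambda>i. \<Sum>j<dim_col A. cmod (A $$ (i, j))) {..<dim_row A}"
    unfolding l2_norm_def by (auto intro!: L2_set_mono)
qed

lemma opnorm_upper:
  assumes "v \<in> carrier_vec (dim_col A)" "l2_norm v \<le> 1"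
  shows "l2_norm (A *\<^sub>v v) \<le> opnorm A"
  unfolding opnorm_def using assms opnorm_bdd by (intro cSUP_upper) auto

lemma opnorm_least:
  assumes "\<And>v. v \<in> carrier_vec (dim_col A) \<Longrightarrow> l2_norm v \<le> 1 \<Longrightarrow> l2_norm (A *\<^sub>v v) \<le> c"
  shows "opnorm A \<le> c"
proof -
  have "0\<^sub>v (dim_col A) \<in> {v \<in> carrier_vec (dim_col A). l2_norm v \<le> 1}"
    by (simp add: l2_norm_def L2_set_def)
  then show ?thesis
    unfolding opnorm_def using assms by (intro cSUP_least) blast+
qed

lemma opnorm_triangle:
  assumes A: "A \<in> carrier_mat m n" and B: "B \<in> carrier_mat m n"
  shows "opnorm (A + B) \<le> opnorm A + opnorm B"
proof (rule opnorm_least)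
  fix v :: "complex vec" assume "v \<in> carrier_vec (dim_col (A + B))" and v1: "l2_norm v \<le> 1"
  then have v: "v \<in> carrier_vec n" using B by simp
  have "l2_norm ((A + B) *\<^sub>v v) = l2_norm (A *\<^sub>v v + B *\<^sub>v v)"
    using A B v by (simp add: add_mult_distrib_mat_vec)
  also have "\<dots> \<le> l2_norm (A *\<^sub>v v) + l2_norm (B *\<^sub>v v)"
    using A B v by (intro l2_norm_add[of _ m]) auto
  also have "\<dots> \<le> opnorm A + opnorm B"
    using A B v v1 by (intro add_mono opnorm_upper) auto
  finally show "l2_norm ((A + B) *\<^sub>v v) \<le> opnorm A + opnorm B" .
qed

text \<open>Convergence in \<^const>\<open>unif_topology\<close> is uniform convergence on every \<open>K_set d \<delta> \<rho>\<close>
  (nets correspond to filters).\<close>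

lemma limitin_unif_topology:
  assumes C: "C \<subseteq> (\<Pi> x \<in> B_set d \<delta>. carrier_mat (fst x) (fst x))"
  shows "limitin (unif_topology d \<delta> C) f l F \<longleftrightarrow>
    l \<in> C \<and> eventually (\<lambda>i. f i \<in> C) F \<and>
    (\<forall>\<rho>. 0 < \<rho> \<and> \<rho> < 1 \<longrightarrow> (\<forall>\<epsilon> > 0.
       eventually (\<lambda>i. \<forall>x \<in> K_set d \<delta> \<rho>. opnorm (f i x - l x) < \<epsilon>) F))"
    (is "?L \<longleftrightarrow> ?R")
proof
  assume L: ?L
  then have l: "l \<in> C" by (simp add: limitin_def)
  have ev: "eventually (\<lambda>i. f i \<in> U) F" if "unif_open d \<delta> C U" "l \<in> U" for U
    using L that by (auto simp: limitin_def openin_unif_topology)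
  have "unif_open d \<delta> C C"
    using openin_topspace[of "unif_topology d \<delta> C"] by (simp add: openin_unif_topology)
  then have fC: "eventually (\<lambda>i. f i \<in> C) F" using ev l by blast
  have "eventually (\<lambda>i. \<forall>x \<in> K_set d \<delta> \<rho>. opnorm (f i x - l x) < \<epsilon>) F"
    if \<rho>: "0 < \<rho>" "\<rho> < 1" and \<epsilon>: "\<epsilon> > 0" for \<rho> \<epsilon>
  proof -
    define U where "U = {g \<in> C. \<exists>\<eta> < \<epsilon>. \<forall>x \<in> K_set d \<delta> \<rho>. opnorm (g x - l x) \<le> \<eta>}"
    have "unif_open d \<delta> C U"
      unfolding unif_open_def
    proof (intro conjI ballI)
      show "U \<subseteq> C" by (auto simp: U_def)
      fix g assume "g \<in> U"
      then obtain \<eta> where g: "g \<in> C" and \<eta>: "\<eta> < \<epsilon>"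
        and le: "\<And>x. x \<in> K_set d \<delta> \<rho> \<Longrightarrow> opnorm (g x - l x) \<le> \<eta>"
        by (auto simp: U_def)
      have "k \<in> U" if k: "k \<in> C"
        and kg: "\<And>x. x \<in> K_set d \<delta> \<rho> \<Longrightarrow> opnorm (k x - g x) < (\<epsilon> - \<eta>) / 2" for k
      proof -
        have "opnorm (k x - l x) \<le> (\<epsilon> + \<eta>) / 2" if x: "x \<in> K_set d \<delta> \<rho>" for x
        proof -
          have xB: "x \<in> B_set d \<delta>" using x by (simp add: K_set_def)
          have m: "k x \<in> carrier_mat (fst x) (fst x)" "g x \<in> carrier_mat (fst x) (fst x)"
            "l x \<in> carrier_mat (fst x) (fst x)"
            using C k g l xB by (auto simp: Pi_iff subset_iff)
          have "k x - l x = (k x - g x) + (g x - l x)"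
            using m by (intro eq_matI) auto
          then have "opnorm (k x - l x) \<le> opnorm (k x - g x) + opnorm (g x - l x)"
            using m by (metis opnorm_triangle minus_carrier_mat)
          also have "\<dots> \<le> (\<epsilon> - \<eta>) / 2 + \<eta>"
            using kg[OF x] le[OF x] by linarith
          finally show ?thesis by (simp add: field_simps)
        qed
        moreover have "(\<epsilon> + \<eta>) / 2 < \<epsilon>" using \<eta> by simp
        ultimately show ?thesis using k unfolding U_def by blast
      qed
      then show "\<exists>\<rho>. 0 < \<rho> \<and> \<rho> < 1 \<and> (\<exists>\<epsilon> > 0.
          {k \<in> C. \<forall>x \<in> K_set d \<delta> \<rho>. opnorm (k x - g x) < \<epsilon>} \<subseteq> U)"
        using \<rho> \<eta> by (intro exI[of _ \<rho>] conjI exI[of _ "(\<epsilon> - \<eta>) / 2"]) auto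
    qed
    moreover have "l \<in> U"
    proof -
      have "opnorm (l x - l x) \<le> 0" if "x \<in> K_set d \<delta> \<rho>" for x
      proof (rule opnorm_least)
        fix v :: "complex vec"
        assume v: "v \<in> carrier_vec (dim_col (l x - l x))"
        have "l x \<in> carrier_mat (fst x) (fst x)"
          using C l that by (auto simp: K_set_def Pi_iff subset_iff)
        then have "(l x - l x) *\<^sub>v v = 0\<^sub>v (fst x)"
          using v by (auto intro!: eq_vecI simp: scalar_prod_def)
        then show "l2_norm ((l x - l x) *\<^sub>v v) \<le> 0"
          by (simp add: l2_norm_def L2_set_def)
      qed
      then show ?thesis using l \<epsilon> by (auto simp: U_def)
    qed
    ultimately have "eventually (\<lambda>i. f i \<in> U) F" by (rule ev)
    then show ?thesis by (rule eventually_mono) (force simp: U_def)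
  qed
  then show ?R using l fC by blast
next
  assume R: ?R
  show ?L
    unfolding limitin_def openin_unif_topology topspace_unif_topology
  proof (intro conjI allI impI)
    show "l \<in> C" using R by blast
    fix U assume U: "unif_open d \<delta> C U \<and> l \<in> U"
    then obtain \<rho> \<epsilon> where 1: "0 < \<rho>" "\<rho> < 1" "\<epsilon> > 0"
      "{g \<in> C. \<forall>x \<in> K_set d \<delta> \<rho>. opnorm (g x - l x) < \<epsilon>} \<subseteq> U"
      unfolding unif_open_def by blast
    have "eventually (\<lambda>i. f i \<in> C \<and> (\<forall>x \<in> K_set d \<delta> \<rho>. opnorm (f i x - l x) < \<epsilon>)) F"
      using R 1 by (simp add: eventually_conj)
    then show "eventually (\<lambda>i. f i \<in> U) F"
      by (rule eventually_mono) (use 1 in blast)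
  qed
qed


section \<open>Cayley transforms\<close>

definition cayley ::
  "nat \<Rightarrow> free_poly mat \<Rightarrow> (nc_point \<Rightarrow> complex mat) \<Rightarrow> nc_point \<Rightarrow> complex mat" where
  "cayley d \<delta> f = (\<lambda>x \<in> B_set d \<delta>. (1\<^sub>m (fst x) + f x) * mat_inv (1\<^sub>m (fst x) - f x))"

definition inv_cayley ::
  "nat \<Rightarrow> free_poly mat \<Rightarrow> (nc_point \<Rightarrow> complex mat) \<Rightarrow> nc_point \<Rightarrow> complex mat" where
  "inv_cayley d \<delta> h = (\<lambda>x \<in> B_set d \<delta>. (h x - 1\<^sub>m (fst x)) * mat_inv (h x + 1\<^sub>m (fst x)))"

end

theory Submission
  imports Defs
begin

text \<open>
  The key point is an nc Schwarz lemma: \<open>\<parallel>f(x)\<parallel> \<le> \<parallel>\<delta>(x)\<parallel>\<close> for \<open>f\<close> in the regular Schur-Agler class.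
  For a scalar \<open>c\<close>, let \<open>y\<close> be the tuple of the block matrices with rows \<open>(0, c x)\<close> and \<open>(0, x)\<close>. The
  columns \<open>(1, 0)\<close> and \<open>(c, 1)\<close> intertwine \<open>0\<close> and \<open>x\<close> with \<open>y\<close>; as \<open>f\<close> and \<open>\<delta>\<close> vanish at \<open>0\<close>, both
  \<open>f(y)\<close> and the blocks of \<open>\<delta>(y)\<close> have the same shape, and their norms are those at \<open>x\<close> multiplied by
  \<open>sqrt (1 + |c|^2)\<close>. Taking this factor just below \<open>1 / \<parallel>\<delta>(x)\<parallel>\<close> keeps \<open>y\<close> in the domain, where
  \<open>\<parallel>f(y)\<parallel> \<le> 1\<close>.

  Hence \<open>I - f(x)\<close> is invertible, with inverse of norm at most \<open>1 / (1 - \<rho>)\<close> where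
  \<open>\<parallel>\<delta>(x)\<parallel> \<le> \<rho>\<close>, while \<open>(h(x) + I)^(-1)\<close> is always a contraction. The resolvent identity
  then makes both Cayley transforms Lipschitz for the uniform norm on each of these sets.
\<close>

section \<open>The Euclidean norm and the operator norm\<close>

lemma l2_norm_sq: "(l2_norm v)\<^sup>2 = (\<Sum>i<dim_vec v. (cmod (v $ i))\<^sup>2)"
  by (simp add: l2_norm_def L2_set_def sum_nonneg)

lemma l2_norm_smult: "l2_norm (a \<cdot>\<^sub>v v) = cmod a * l2_norm v"
  unfolding l2_norm_def L2_set_right_distrib[OF norm_ge_zero] by (intro L2_set_cong) (auto simp: norm_mult)

lemma l2_norm_eq_0_iff: "v \<in> carrier_vec n \<Longrightarrow> l2_norm v = 0 \<longleftrightarrow> v = 0\<^sub>v n"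
  by (auto simp: l2_norm_def L2_set_eq_0_iff)

lemma l2_norm_sq_add:
  assumes "u \<in> carrier_vec n" "w \<in> carrier_vec n"
  shows "(l2_norm (u + w))\<^sup>2 = (l2_norm u)\<^sup>2 + (l2_norm w)\<^sup>2 + 2 * Re (u \<bullet>c w)"
proof -
  have "(cmod (a + b))\<^sup>2 = (cmod a)\<^sup>2 + (cmod b)\<^sup>2 + 2 * Re (a * cnj b)" for a b
    unfolding cmod_power2 by (simp add: power2_eq_square algebra_simps)
  then show ?thesis
    using assms by (simp add: l2_norm_sq scalar_prod_def atLeast0LessThan sum.distrib sum_distrib_left)
qed

lemma l2_norm_sq_minus:
  assumes "u \<in> carrier_vec n" "w \<in> carrier_vec n"
  shows "(l2_norm (u - w))\<^sup>2 = (l2_norm u)\<^sup>2 + (l2_norm w)\<^sup>2 - 2 * Re (u \<bullet>c w)"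
proof -
  have "(cmod (a - b))\<^sup>2 = (cmod a)\<^sup>2 + (cmod b)\<^sup>2 - 2 * Re (a * cnj b)" for a b
    unfolding cmod_power2 by (simp add: power2_eq_square algebra_simps)
  then show ?thesis
    using assms by (simp add: l2_norm_sq scalar_prod_def atLeast0LessThan sum.distrib
        sum_subtractf sum_distrib_left)
qed

lemma Re_scalar_prod_add_minus:
  assumes "u \<in> carrier_vec n" "w \<in> carrier_vec n"
  shows "Re ((u + w) \<bullet>c (u - w)) = (l2_norm u)\<^sup>2 - (l2_norm w)\<^sup>2"
proof -
  have "Re ((a + b) * cnj (a - b)) = (cmod a)\<^sup>2 - (cmod b)\<^sup>2" for a b
    unfolding cmod_power2 by (simp add: power2_eq_square algebra_simps)
  then show ?thesis
    using assms by (simp add: l2_norm_sq scalar_prod_def atLeast0LessThan sum_subtractf)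
qed

lemma sum_lessThan_add:
  fixes g :: "nat \<Rightarrow> 'a :: comm_monoid_add"
  shows "sum g {..<m + n} = sum g {..<m} + (\<Sum>j<n. g (m + j))"
  by (induction n) (simp_all add: add.assoc)

lemma l2_norm_append_vec: "(l2_norm (u @\<^sub>v w))\<^sup>2 = (l2_norm u)\<^sup>2 + (l2_norm w)\<^sup>2"
  by (simp add: l2_norm_sq sum_lessThan_add)

lemma opnorm_nonneg: "0 \<le> opnorm A"
proof -
  have "l2_norm (A *\<^sub>v 0\<^sub>v (dim_col A)) \<le> opnorm A"
    by (intro opnorm_upper) (simp_all add: l2_norm_def L2_set_def)
  then show ?thesis
    using l2_norm_nonneg order_trans by blast
qed

lemma l2_norm_mult_mat_vec_le:
  assumes A: "A \<in> carrier_mat m n" and v: "v \<in> carrier_vec n"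
  shows "l2_norm (A *\<^sub>v v) \<le> opnorm A * l2_norm v"
proof (cases "l2_norm v = 0")
  case True
  then have "A *\<^sub>v v = 0\<^sub>v m"
    using A v by (auto simp: l2_norm_eq_0_iff intro!: eq_vecI)
  then show ?thesis
    using True by (simp add: l2_norm_def L2_set_def)
next
  case False
  then have pos: "l2_norm v > 0"
    using l2_norm_nonneg[of v] by simp
  define c where "c = complex_of_real (1 / l2_norm v)"
  have c: "cmod c = 1 / l2_norm v"
    using pos by (simp add: c_def norm_divide)
  have "l2_norm (A *\<^sub>v (c \<cdot>\<^sub>v v)) \<le> opnorm A"
    using A v pos c by (intro opnorm_upper) (auto simp: l2_norm_smult)
  moreover have "A *\<^sub>v (c \<cdot>\<^sub>v v) = c \<cdot>\<^sub>v (A *\<^sub>v v)"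
    using A v by (rule mult_mat_vec)
  ultimately show ?thesis
    using pos c by (simp add: l2_norm_smult field_simps)
qed

lemma opnorm_leI:
  assumes A: "A \<in> carrier_mat m n" and c: "0 \<le> c"
    and le: "\<And>v. v \<in> carrier_vec n \<Longrightarrow> l2_norm (A *\<^sub>v v) \<le> c * l2_norm v"
  shows "opnorm A \<le> c"
proof (rule opnorm_least)
  fix v :: "complex vec" assume v: "v \<in> carrier_vec (dim_col A)" "l2_norm v \<le> 1"
  then have "l2_norm (A *\<^sub>v v) \<le> c * l2_norm v"
    using A by (intro le) auto
  also have "\<dots> \<le> c"
    using c v by (simp add: mult_left_le)
  finally show "l2_norm (A *\<^sub>v v) \<le> c" .
qed

lemma opnorm_mult_le:
  assumes A: "A \<in> carrier_mat l m" and B: "B \<in> carrier_mat m n"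
  shows "opnorm (A * B) \<le> opnorm A * opnorm B"
proof (rule opnorm_leI[of _ l n])
  fix v :: "complex vec" assume v: "v \<in> carrier_vec n"
  have "l2_norm (A * B *\<^sub>v v) \<le> opnorm A * l2_norm (B *\<^sub>v v)"
    using A B v l2_norm_mult_mat_vec_le[OF A, of "B *\<^sub>v v"] by simp
  also have "\<dots> \<le> opnorm A * (opnorm B * l2_norm v)"
    using B v by (intro mult_left_mono l2_norm_mult_mat_vec_le opnorm_nonneg)
  finally show "l2_norm (A * B *\<^sub>v v) \<le> opnorm A * opnorm B * l2_norm v"
    by (simp add: mult.assoc)
qed (use A B in \<open>auto simp: opnorm_nonneg\<close>)

lemma opnorm_smult_le:
  assumes A: "A \<in> carrier_mat m n"
  shows "opnorm (a \<cdot>\<^sub>m A) \<le> cmod a * opnorm A"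
proof (rule opnorm_leI[of _ m n])
  fix v :: "complex vec" assume v: "v \<in> carrier_vec n"
  have "(a \<cdot>\<^sub>m A) *\<^sub>v v = a \<cdot>\<^sub>v (A *\<^sub>v v)"
    using A v by (intro eq_vecI) auto
  then show "l2_norm ((a \<cdot>\<^sub>m A) *\<^sub>v v) \<le> cmod a * opnorm A * l2_norm v"
    using l2_norm_mult_mat_vec_le[OF A v] by (simp add: l2_norm_smult mult.assoc mult_left_mono)
qed (use A in \<open>auto simp: opnorm_nonneg\<close>)

lemma opnorm_zero [simp]: "opnorm (0\<^sub>m m n) = 0"
proof -
  have "opnorm (0\<^sub>m m n) \<le> 0"
    by (rule opnorm_leI[of _ m n]) (auto simp: l2_norm_def L2_set_def)
  then show ?thesis
    using opnorm_nonneg[of "0\<^sub>m m n"] by simp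
qed

lemma mult_Re_mat_scalar_prod:
  assumes A: "A \<in> carrier_mat n n" and v: "v \<in> carrier_vec n"
  shows "(Re_mat A *\<^sub>v v) \<bullet>c v = complex_of_real (Re ((A *\<^sub>v v) \<bullet>c v))"
proof -
  have adj: "mat_adjoint A $$ (i, j) = cnj (A $$ (j, i))" if "i < n" "j < n" for i j
    using A that by (simp add: mat_adjoint_def mat_of_rows_def)
  have dim: "mat_adjoint A \<in> carrier_mat n n"
    using A by (auto simp: mat_adjoint_def)
  let ?S = "\<Sum>i<n. \<Sum>j<n. A $$ (i, j) * v $ j * cnj (v $ i)"
  have S: "(A *\<^sub>v v) \<bullet>c v = ?S"
    using A v by (simp add: scalar_prod_def atLeast0LessThan sum_distrib_right)
  have "(Re_mat A *\<^sub>v v) \<bullet>c v =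
      (\<Sum>i<n. \<Sum>j<n. (A $$ (i, j) + cnj (A $$ (j, i))) / 2 * v $ j * cnj (v $ i))"
    using A v dim adj
    by (simp add: Re_mat_def scalar_prod_def atLeast0LessThan sum_distrib_right)
  also have "\<dots> = (?S + (\<Sum>i<n. \<Sum>j<n. cnj (A $$ (j, i)) * v $ j * cnj (v $ i))) / 2"
    by (simp only: add_divide_distrib distrib_right sum.distrib sum_divide_distrib times_divide_eq_left)
  also have "(\<Sum>i<n. \<Sum>j<n. cnj (A $$ (j, i)) * v $ j * cnj (v $ i)) = cnj ?S"
    by (subst sum.swap) (simp add: ac_simps)
  also have "(z + cnj z) / 2 = complex_of_real (Re z)" for z
    by (simp add: complex_add_cnj)
  finally show ?thesis
    by (simp add: S)
qed

lemma psd_Re_mat_iff: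
  assumes A: "A \<in> carrier_mat n n"
  shows "psd_mat (Re_mat A) \<longleftrightarrow> (\<forall>v \<in> carrier_vec n. 0 \<le> Re ((A *\<^sub>v v) \<bullet>c v))"
proof -
  have "Re_mat A \<in> carrier_mat n n"
    using A by (auto simp: Re_mat_def mat_adjoint_def)
  then show ?thesis
    using mult_Re_mat_scalar_prod[OF A] by (auto simp: psd_mat_def less_eq_complex_def)
qed


section \<open>Inverses and Cayley transforms of matrices\<close>

lemma invertible_mat_if_bounded_below:
  assumes A: "A \<in> carrier_mat n n" and c: "c > 0"
    and le: "\<And>v. v \<in> carrier_vec n \<Longrightarrow> c * l2_norm v \<le> l2_norm (A *\<^sub>v v)"
  shows "invertible_mat A"
proof -
  have "v = 0\<^sub>v n" if v: "v \<in> carrier_vec n" and "A *\<^sub>v v = 0\<^sub>v n" for v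
  proof -
    have "l2_norm (0\<^sub>v n) = 0"
      by (simp add: l2_norm_def L2_set_def)
    then have "c * l2_norm v \<le> 0"
      using le[OF v] that by simp
    then show ?thesis
      using c l2_norm_nonneg[of v] v by (simp add: l2_norm_eq_0_iff[symmetric] mult_le_0_iff)
  qed
  then have "det A \<noteq> 0"
    using det_0_iff_vec_prod_zero_field[OF A] by blast
  then have "A \<in> Units (ring_mat TYPE(complex) n ())"
    by (rule det_non_zero_imp_unit[OF A])
  then show ?thesis
    using A by (auto simp: Units_def ring_mat_def invertible_mat_def inverts_mat_def)
qed

lemma mat_inv:
  assumes A: "A \<in> carrier_mat n n" and inv: "invertible_mat A"
  shows "mat_inv A \<in> carrier_mat n n" "A * mat_inv A = 1\<^sub>m n" "mat_inv A * A = 1\<^sub>m n"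
proof -
  obtain B where B: "A * B = 1\<^sub>m n" "B * A = 1\<^sub>m (dim_row B)"
    using A inv by (auto simp: invertible_mat_def inverts_mat_def)
  have "dim_row B = n" "dim_col B = n"
    using A arg_cong[OF B(1), of dim_col] arg_cong[OF B(2), of dim_col] by auto
  then have "A \<in> Units (ring_mat TYPE(complex) n ())"
    using A B by (auto simp: Units_def ring_mat_def intro!: bexI[of _ B])
  then obtain C where C: "mat_inverse A = Some C"
    using mat_inverse(1)[OF A] by fastforce
  show "mat_inv A \<in> carrier_mat n n" "A * mat_inv A = 1\<^sub>m n" "mat_inv A * A = 1\<^sub>m n"
    using mat_inverse(2)[OF A C] C by (auto simp: mat_inv_def)
qed

lemma mat_inv_unique:
  assumes A: "A \<in> carrier_mat n n" and B: "B \<in> carrier_mat n n" and AB: "A * B = 1\<^sub>m n"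
  shows "mat_inv A = B"
proof -
  have BA: "B * A = 1\<^sub>m n"
    using mat_mult_left_right_inverse[OF A B AB] .
  then have "invertible_mat A"
    using A B AB by (auto simp: invertible_mat_def inverts_mat_def intro!: exI[of _ B])
  note C = mat_inv[OF A this]
  have "mat_inv A = (B * A) * mat_inv A"
    using C by (simp add: BA)
  also have "\<dots> = B"
    using A B C by (simp add: assoc_mult_mat[OF B A C(1)])
  finally show ?thesis .
qed

lemma opnorm_mat_inv_le:
  assumes A: "A \<in> carrier_mat n n" and c: "c > 0"
    and le: "\<And>v. v \<in> carrier_vec n \<Longrightarrow> c * l2_norm v \<le> l2_norm (A *\<^sub>v v)"
  shows "opnorm (mat_inv A) \<le> 1 / c"
proof (rule opnorm_leI[of _ n n])
  note inv = mat_inv[OF A invertible_mat_if_bounded_below[OF A c le]]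
  show "mat_inv A \<in> carrier_mat n n"
    by (rule inv)
  fix v :: "complex vec" assume v: "v \<in> carrier_vec n"
  have "c * l2_norm (mat_inv A *\<^sub>v v) \<le> l2_norm (A *\<^sub>v (mat_inv A *\<^sub>v v))"
    using inv v by (intro le) auto
  also have "A *\<^sub>v (mat_inv A *\<^sub>v v) = v"
    using inv(2) v by (simp flip: assoc_mult_mat_vec[OF A inv(1) v])
  finally show "l2_norm (mat_inv A *\<^sub>v v) \<le> 1 / c * l2_norm v"
    using c by (simp add: field_simps)
qed (use c in simp)

lemma mat_inv_intertwine:
  assumes A: "A \<in> carrier_mat n n" "invertible_mat A"
    and B: "B \<in> carrier_mat m m" "invertible_mat B"
    and \<alpha>: "\<alpha> \<in> carrier_mat m n" and eq: "\<alpha> * A = B * \<alpha>"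
  shows "\<alpha> * mat_inv A = mat_inv B * \<alpha>"
proof -
  note A' = mat_inv[OF A] and B' = mat_inv[OF B]
  have "\<alpha> * mat_inv A = (mat_inv B * B) * (\<alpha> * mat_inv A)"
    unfolding B'(3) using \<alpha> A'(1) by (intro left_mult_one_mat[of _ m n, symmetric]) simp
  also have "\<dots> = mat_inv B * ((B * \<alpha>) * mat_inv A)"
    using \<alpha> A'(1) B'(1) B(1)
    by (simp add: assoc_mult_mat[of _ m m _ m _ n] assoc_mult_mat[of _ m m _ n _ n])
  also have "\<dots> = mat_inv B * \<alpha>"
    using \<alpha> A(1) A'(1,2) by (simp add: eq[symmetric] assoc_mult_mat[of _ m n _ n _ n])
  finally show ?thesis .
qed

lemma mat_inv_diff:
  assumes A: "A \<in> carrier_mat n n" "invertible_mat A"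
    and B: "B \<in> carrier_mat n n" "invertible_mat B"
  shows "mat_inv A - mat_inv B = mat_inv A * (B - A) * mat_inv B"
proof -
  note A' = mat_inv[OF A] and B' = mat_inv[OF B]
  have "mat_inv A * (B - A) * mat_inv B = mat_inv A * B * mat_inv B - mat_inv A * A * mat_inv B"
    using A B A' B' by (simp add: mult_minus_distrib_mat[of _ n n _ n] minus_mult_distrib_mat[of _ n n _ _ n])
  also have "mat_inv A * B * mat_inv B = mat_inv A"
    using A B A' B' by (simp add: assoc_mult_mat[of _ n n _ n _ n])
  finally show ?thesis
    using A' B' by simp
qed

lemma cayley_mat_eq:
  assumes F: "F \<in> carrier_mat n n" and inv: "invertible_mat (1\<^sub>m n - F)"
  shows "(1\<^sub>m n + F) * mat_inv (1\<^sub>m n - F) = 2 \<cdot>\<^sub>m mat_inv (1\<^sub>m n - F) - 1\<^sub>m n"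
proof -
  let ?G = "1\<^sub>m n - F"
  note R = mat_inv[OF minus_carrier_mat[OF F] inv]
  have "1\<^sub>m n + F = 2 \<cdot>\<^sub>m 1\<^sub>m n - ?G"
    using F by (intro eq_matI) auto
  then have "(1\<^sub>m n + F) * mat_inv ?G = (2 \<cdot>\<^sub>m 1\<^sub>m n) * mat_inv ?G - ?G * mat_inv ?G"
    using minus_mult_distrib_mat[OF _ minus_carrier_mat[OF F] R(1), of "2 \<cdot>\<^sub>m 1\<^sub>m n"] by simp
  then show ?thesis
    unfolding R(2) using R(1) by (simp add: mult_smult_assoc_mat[of _ n n _ n])
qed

lemma inv_cayley_mat_eq:
  assumes H: "H \<in> carrier_mat n n" and inv: "invertible_mat (H + 1\<^sub>m n)"
  shows "(H - 1\<^sub>m n) * mat_inv (H + 1\<^sub>m n) = 1\<^sub>m n - 2 \<cdot>\<^sub>m mat_inv (H + 1\<^sub>m n)"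
proof -
  let ?G = "H + 1\<^sub>m n"
  have G: "?G \<in> carrier_mat n n"
    using H by simp
  note R = mat_inv[OF G inv]
  have "H - 1\<^sub>m n = ?G - 2 \<cdot>\<^sub>m 1\<^sub>m n"
    using H by (intro eq_matI) auto
  then have "(H - 1\<^sub>m n) * mat_inv ?G = ?G * mat_inv ?G - (2 \<cdot>\<^sub>m 1\<^sub>m n) * mat_inv ?G"
    using R(1) G minus_mult_distrib_mat[OF G _ R(1), of "2 \<cdot>\<^sub>m 1\<^sub>m n"] by simp
  then show ?thesis
    unfolding R(2) using R(1) by (simp add: mult_smult_assoc_mat[of _ n n _ n])
qed

lemma mat_inv_smult_mat_inv:
  assumes A: "A \<in> carrier_mat n n" "invertible_mat A" and a: "a \<noteq> 0"
  shows "invertible_mat (a \<cdot>\<^sub>m mat_inv A)" "mat_inv (a \<cdot>\<^sub>m mat_inv A) = (1 / a) \<cdot>\<^sub>m A"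
proof -
  note R = mat_inv[OF A]
  let ?X = "a \<cdot>\<^sub>m mat_inv A" and ?Y = "(1 / a) \<cdot>\<^sub>m A"
  have X: "?X \<in> carrier_mat n n" and Y: "?Y \<in> carrier_mat n n"
    using R A by auto
  have "?X * ?Y = a \<cdot>\<^sub>m ((1 / a) \<cdot>\<^sub>m (mat_inv A * A))"
    using R(1) A(1) mult_smult_assoc_mat[OF R(1) Y, of a] by (simp add: mult_smult_distrib[of _ n n _ n])
  also have "\<dots> = 1\<^sub>m n"
    unfolding R(3) using a by (intro eq_matI) auto
  finally have XY: "?X * ?Y = 1\<^sub>m n" .
  show "mat_inv ?X = ?Y"
    by (rule mat_inv_unique[OF X Y XY])
  show "invertible_mat ?X"
    using XY mat_mult_left_right_inverse[OF X Y XY] A R(1)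
    by (auto simp: invertible_mat_def inverts_mat_def intro!: exI[of _ ?Y])
qed

lemma inv_cayley_cayley_mat:
  assumes F: "F \<in> carrier_mat n n" and inv: "invertible_mat (1\<^sub>m n - F)"
    and H: "H = (1\<^sub>m n + F) * mat_inv (1\<^sub>m n - F)"
  shows "(H - 1\<^sub>m n) * mat_inv (H + 1\<^sub>m n) = F"
proof -
  let ?R = "mat_inv (1\<^sub>m n - F)"
  have F1: "1\<^sub>m n - F \<in> carrier_mat n n"
    using F by auto
  note R = mat_inv[OF F1 inv]
  have H': "H = 2 \<cdot>\<^sub>m ?R - 1\<^sub>m n"
    unfolding H by (rule cayley_mat_eq[OF F inv])
  have H1: "H + 1\<^sub>m n = 2 \<cdot>\<^sub>m ?R"
    unfolding H' using R(1) by (intro eq_matI) auto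
  note inv1 = mat_inv_smult_mat_inv[OF F1 inv, of 2, folded H1]
  have "(H - 1\<^sub>m n) * mat_inv (H + 1\<^sub>m n) = 1\<^sub>m n - 2 \<cdot>\<^sub>m mat_inv (H + 1\<^sub>m n)"
    using R(1) H' inv1(1) by (intro inv_cayley_mat_eq) auto
  also have "\<dots> = 1\<^sub>m n - 2 \<cdot>\<^sub>m ((1 / 2) \<cdot>\<^sub>m (1\<^sub>m n - F))"
    by (simp add: inv1(2))
  also have "\<dots> = F"
    using F by (intro eq_matI) (auto simp: field_simps)
  finally show ?thesis .
qed

lemma cayley_inv_cayley_mat:
  assumes H: "H \<in> carrier_mat n n" and inv: "invertible_mat (H + 1\<^sub>m n)"
    and F: "F = (H - 1\<^sub>m n) * mat_inv (H + 1\<^sub>m n)"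
  shows "(1\<^sub>m n + F) * mat_inv (1\<^sub>m n - F) = H"
proof -
  let ?R = "mat_inv (H + 1\<^sub>m n)"
  have H1: "H + 1\<^sub>m n \<in> carrier_mat n n"
    using H by auto
  note R = mat_inv[OF H1 inv]
  have F': "F = 1\<^sub>m n - 2 \<cdot>\<^sub>m ?R"
    unfolding F by (rule inv_cayley_mat_eq[OF H inv])
  have F1: "1\<^sub>m n - F = 2 \<cdot>\<^sub>m ?R"
    unfolding F' using R(1) by (intro eq_matI) auto
  note inv1 = mat_inv_smult_mat_inv[OF H1 inv, of 2, folded F1]
  have "(1\<^sub>m n + F) * mat_inv (1\<^sub>m n - F) = 2 \<cdot>\<^sub>m mat_inv (1\<^sub>m n - F) - 1\<^sub>m n"
    using R(1) F' inv1(1) by (intro cayley_mat_eq) auto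
  also have "\<dots> = 2 \<cdot>\<^sub>m ((1 / 2) \<cdot>\<^sub>m (H + 1\<^sub>m n)) - 1\<^sub>m n"
    by (simp add: inv1(2))
  also have "\<dots> = H"
    using H by (intro eq_matI) (auto simp: field_simps)
  finally show ?thesis .
qed


section \<open>Intertwiners of free polynomials\<close>

lemma word_eval_carrier:
  assumes "(n, x) \<in> nc_space d" "set w \<subseteq> {..<d}"
  shows "word_eval w (n, x) \<in> carrier_mat n n"
  using assms
proof (induction w)
  case (Cons i w)
  then have "x ! i \<in> carrier_mat n n"
    by (auto simp: nc_space_def mat_tuples_def)
  with Cons show ?case
    by (simp add: word_eval_def)
qed (simp add: word_eval_def)

lemma word_eval_intertwine:
  assumes x: "(n, x) \<in> nc_space d" and y: "(m, y) \<in> nc_space d" and \<alpha>: "\<alpha> \<in> carrier_mat m n"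
    and eq: "\<And>i. i < d \<Longrightarrow> \<alpha> * x ! i = y ! i * \<alpha>" and w: "set w \<subseteq> {..<d}"
  shows "\<alpha> * word_eval w (n, x) = word_eval w (m, y) * \<alpha>"
  using w
proof (induction w)
  case Nil
  then show ?case
    using \<alpha> by (simp add: word_eval_def)
next
  case (Cons i w)
  let ?X = "word_eval w (n, x)" and ?Y = "word_eval w (m, y)"
  have X: "x ! i \<in> carrier_mat n n" "?X \<in> carrier_mat n n"
    and Y: "y ! i \<in> carrier_mat m m" "?Y \<in> carrier_mat m m"
    using Cons.prems x y word_eval_carrier[OF x] word_eval_carrier[OF y]
    by (auto simp: nc_space_def mat_tuples_def)
  have "\<alpha> * (x ! i * ?X) = (\<alpha> * x ! i) * ?X"
    by (rule assoc_mult_mat[symmetric, OF \<alpha> X])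
  also have "\<dots> = (y ! i * \<alpha>) * ?X"
    using Cons.prems by (simp add: eq)
  also have "\<dots> = y ! i * (\<alpha> * ?X)"
    by (rule assoc_mult_mat[OF Y(1) \<alpha> X(2)])
  also have "\<alpha> * ?X = ?Y * \<alpha>"
    using Cons by simp
  also have "y ! i * (?Y * \<alpha>) = y ! i * ?Y * \<alpha>"
    by (rule assoc_mult_mat[symmetric, OF Y \<alpha>])
  finally show ?case
    by (simp add: word_eval_def)
qed

lemma free_poly_eval_carrier: "free_poly_eval p (n, x) \<in> carrier_mat n n"
  by (simp add: free_poly_eval_def)

lemma free_poly_eval_intertwine:
  assumes x: "(n, x) \<in> nc_space d" and y: "(m, y) \<in> nc_space d" and \<alpha>: "\<alpha> \<in> carrier_mat m n"
    and eq: "\<And>i. i < d \<Longrightarrow> \<alpha> * x ! i = y ! i * \<alpha>" and p: "p \<in> free_polys d"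
  shows "\<alpha> * free_poly_eval p (n, x) = free_poly_eval p (m, y) * \<alpha>"
proof (rule eq_matI)
  let ?K = "Poly_Mapping.keys p" and ?c = "Poly_Mapping.lookup p"
  fix i j assume "i < dim_row (free_poly_eval p (m, y) * \<alpha>)" "j < dim_col (free_poly_eval p (m, y) * \<alpha>)"
  then have ij: "i < m" "j < n"
    using \<alpha> by (auto simp: free_poly_eval_def)
  have w: "set w \<subseteq> {..<d}" if "w \<in> ?K" for w
    using p that by (auto simp: free_polys_def)
  have "(\<alpha> * free_poly_eval p (n, x)) $$ (i, j) =
      (\<Sum>k<n. \<Sum>w\<in>?K. ?c w * (\<alpha> $$ (i, k) * word_eval w (n, x) $$ (k, j)))"
    using \<alpha> ij
    by (simp add: free_poly_eval_def scalar_prod_def atLeast0LessThan sum_distrib_left mult.left_commute)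
  also have "\<dots> = (\<Sum>w\<in>?K. ?c w * (\<alpha> * word_eval w (n, x)) $$ (i, j))"
  proof (subst sum.swap, rule sum.cong)
    fix w assume "w \<in> ?K"
    then show "(\<Sum>k<n. ?c w * (\<alpha> $$ (i, k) * word_eval w (n, x) $$ (k, j))) =
        ?c w * (\<alpha> * word_eval w (n, x)) $$ (i, j)"
      using \<alpha> ij word_eval_carrier[OF x w, of w]
      by (simp add: scalar_prod_def atLeast0LessThan sum_distrib_left)
  qed simp
  also have "\<dots> = (\<Sum>w\<in>?K. ?c w * (word_eval w (m, y) * \<alpha>) $$ (i, j))"
    using word_eval_intertwine[OF x y \<alpha> eq] w by simp
  also have "\<dots> = (\<Sum>k<m. \<Sum>w\<in>?K. ?c w * word_eval w (m, y) $$ (i, k) * \<alpha> $$ (k, j))"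
  proof (subst sum.swap, rule sum.cong)
    fix w assume "w \<in> ?K"
    then show "?c w * (word_eval w (m, y) * \<alpha>) $$ (i, j) =
        (\<Sum>k<m. ?c w * word_eval w (m, y) $$ (i, k) * \<alpha> $$ (k, j))"
      using \<alpha> ij word_eval_carrier[OF y w, of w]
      by (simp add: scalar_prod_def atLeast0LessThan sum_distrib_left mult.assoc)
  qed simp
  also have "\<dots> = (free_poly_eval p (m, y) * \<alpha>) $$ (i, j)"
    using \<alpha> ij by (simp add: free_poly_eval_def scalar_prod_def atLeast0LessThan sum_distrib_right)
  finally show "(\<alpha> * free_poly_eval p (n, x)) $$ (i, j) = (free_poly_eval p (m, y) * \<alpha>) $$ (i, j)" .
qed (use \<alpha> in \<open>auto simp: free_poly_eval_def\<close>)


section \<open>Dilations\<close>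

text \<open>The block matrix with rows \<open>(0, c N)\<close> and \<open>(0, N)\<close>.\<close>

definition dilate :: "complex \<Rightarrow> complex mat \<Rightarrow> complex mat" where
  "dilate c N = (let n = dim_row N in mat (n + n) (n + n)
     (\<lambda>(i, j). if j < n then 0 else if i < n then c * N $$ (i, j - n) else N $$ (i - n, j - n)))"

definition scalar_column :: "complex \<Rightarrow> complex \<Rightarrow> nat \<Rightarrow> complex mat" where
  "scalar_column a b n = mat (n + n) n (\<lambda>(i, j). if i = j then a else if i = n + j then b else 0)"

lemma dilate_carrier: "N \<in> carrier_mat n n \<Longrightarrow> dilate c N \<in> carrier_mat (n + n) (n + n)"
  by (auto simp: dilate_def Let_def)

lemma dilate_index:
  assumes "N \<in> carrier_mat n n" "i < n + n" "j < n"
  shows "dilate c N $$ (i, j) = 0"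
    and "dilate c N $$ (i, n + j) = (if i < n then c * N $$ (i, j) else N $$ (i - n, j))"
  using assms by (auto simp: dilate_def Let_def)

lemma scalar_column_carrier: "scalar_column a b n \<in> carrier_mat (n + n) n"
  by (simp add: scalar_column_def)

lemma mult_scalar_column:
  assumes "M \<in> carrier_mat m (n + n)" "i < m" "j < n"
  shows "(M * scalar_column a b n) $$ (i, j) = M $$ (i, j) * a + M $$ (i, n + j) * b"
proof -
  have "(M * scalar_column a b n) $$ (i, j) =
      (\<Sum>k<n. M $$ (i, k) * scalar_column a b n $$ (k, j)) +
      (\<Sum>k<n. M $$ (i, n + k) * scalar_column a b n $$ (n + k, j))"
    using assms scalar_column_carrier[of a b n]
    by (simp add: scalar_prod_def atLeast0LessThan sum_lessThan_add)
  also have "(\<Sum>k<n. M $$ (i, k) * scalar_column a b n $$ (k, j)) =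
      (\<Sum>k<n. if k = j then M $$ (i, j) * a else 0)"
    using assms by (intro sum.cong) (auto simp: scalar_column_def)
  also have "(\<Sum>k<n. M $$ (i, n + k) * scalar_column a b n $$ (n + k, j)) =
      (\<Sum>k<n. if k = j then M $$ (i, n + j) * b else 0)"
    using assms by (intro sum.cong) (auto simp: scalar_column_def)
  finally show ?thesis
    using assms by simp
qed

lemma scalar_column_mult:
  assumes "N \<in> carrier_mat n m" "i < n + n" "j < m"
  shows "(scalar_column a b n * N) $$ (i, j) = (if i < n then a * N $$ (i, j) else b * N $$ (i - n, j))"
proof -
  have "(scalar_column a b n * N) $$ (i, j) = (\<Sum>k<n. scalar_column a b n $$ (i, k) * N $$ (k, j))"
    using assms scalar_column_carrier[of a b n]
    by (simp add: scalar_prod_def atLeast0LessThan)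
  also have "\<dots> = (\<Sum>k<n. if k = (if i < n then i else i - n)
      then (if i < n then a * N $$ (i, j) else b * N $$ (i - n, j)) else 0)"
    using assms by (intro sum.cong) (auto simp: scalar_column_def)
  also have "\<dots> = (if i < n then a * N $$ (i, j) else b * N $$ (i - n, j))"
    using assms by (subst sum.delta) auto
  finally show ?thesis .
qed

text \<open>Intertwining with two columns characterises \<open>dilate c N\<close>, so anything that respects
  intertwiners commutes with \<open>dilate c\<close>.\<close>

lemma dilate_intertwine:
  assumes N: "N \<in> carrier_mat n n"
  shows "scalar_column 1 0 n * 0\<^sub>m n n = dilate c N * scalar_column 1 0 n"
    and "scalar_column c 1 n * N = dilate c N * scalar_column c 1 n"
proof -
  note carr = dilate_carrier[OF N, of c] scalar_column_carrier[of 1 0 n] scalar_column_carrier[of c 1 n]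
  show "scalar_column 1 0 n * 0\<^sub>m n n = dilate c N * scalar_column 1 0 n"
  proof (rule eq_matI)
    fix i j assume "i < dim_row (dilate c N * scalar_column 1 0 n)"
      "j < dim_col (dilate c N * scalar_column 1 0 n)"
    then have "i < n + n" "j < n"
      using carr by auto
    then show "(scalar_column 1 0 n * 0\<^sub>m n n) $$ (i, j) = (dilate c N * scalar_column 1 0 n) $$ (i, j)"
      using N mult_scalar_column[OF carr(1), of i j 1 0] scalar_column_mult[of "0\<^sub>m n n" n n i j 1 0]
      by (simp add: dilate_def Let_def del: index_mult_mat)
  qed (use carr in auto)
  show "scalar_column c 1 n * N = dilate c N * scalar_column c 1 n"
  proof (rule eq_matI)
    fix i j assume "i < dim_row (dilate c N * scalar_column c 1 n)"
      "j < dim_col (dilate c N * scalar_column c 1 n)"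
    then have "i < n + n" "j < n"
      using carr by auto
    then show "(scalar_column c 1 n * N) $$ (i, j) = (dilate c N * scalar_column c 1 n) $$ (i, j)"
      using N mult_scalar_column[OF carr(1), of i j c 1] scalar_column_mult[OF N, of i j c 1]
      by (simp add: dilate_def Let_def del: index_mult_mat)
  qed (use carr N in auto)
qed

lemma eq_dilate_if_intertwine:
  assumes F: "F \<in> carrier_mat (n + n) (n + n)" and N: "N \<in> carrier_mat n n"
    and 0: "scalar_column 1 0 n * 0\<^sub>m n n = F * scalar_column 1 0 n"
    and c: "scalar_column c 1 n * N = F * scalar_column c 1 n"
  shows "F = dilate c N"
proof (rule eq_matI)
  fix i j assume "i < dim_row (dilate c N)" "j < dim_col (dilate c N)"
  then have i: "i < n + n" and j: "j < n + n"
    using dilate_carrier[OF N, of c] by auto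
  have F0: "F $$ (i, k) = 0" if "k < n" for k
    using arg_cong[OF 0, of "\<lambda>M. M $$ (i, k)"] that i mult_scalar_column[OF F i that, of 1 0]
      scalar_column_mult[of "0\<^sub>m n n" n n i k 1 0]
    by (simp del: index_mult_mat split: if_splits)
  have "F $$ (i, n + k) = (if i < n then c * N $$ (i, k) else N $$ (i - n, k))" if "k < n" for k
    using arg_cong[OF c, of "\<lambda>M. M $$ (i, k)"] that i mult_scalar_column[OF F i that, of c 1]
      scalar_column_mult[OF N i that, of c 1] F0[OF that]
    by (cases "i < n") (simp_all del: index_mult_mat)
  from this[of "j - n"] F0[of j] show "F $$ (i, j) = dilate c N $$ (i, j)"
    using i j N by (auto simp: dilate_def Let_def)
qed (use F dilate_carrier[OF N, of c] in auto)

lemma opnorm_le_opnorm_dilate: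
  assumes N: "N \<in> carrier_mat n n"
  shows "sqrt (1 + (cmod c)\<^sup>2) * opnorm N \<le> opnorm (dilate c N)"
proof -
  let ?t = "sqrt (1 + (cmod c)\<^sup>2)"
  have t: "?t > 0"
    by (simp add: add_pos_nonneg)
  have "opnorm N \<le> opnorm (dilate c N) / ?t"
  proof (rule opnorm_leI[OF N])
    fix v :: "complex vec" assume v: "v \<in> carrier_vec n"
    have eq: "dilate c N *\<^sub>v (0\<^sub>v n @\<^sub>v v) = (c \<cdot>\<^sub>v (N *\<^sub>v v)) @\<^sub>v (N *\<^sub>v v)"
    proof (rule eq_vecI)
      fix i assume "i < dim_vec ((c \<cdot>\<^sub>v (N *\<^sub>v v)) @\<^sub>v (N *\<^sub>v v))"
      then have "i < n + n"
        using N by simp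
      then show "(dilate c N *\<^sub>v (0\<^sub>v n @\<^sub>v v)) $ i = ((c \<cdot>\<^sub>v (N *\<^sub>v v)) @\<^sub>v (N *\<^sub>v v)) $ i"
        using N v by (auto simp: dilate_def Let_def scalar_prod_def atLeast0LessThan sum_lessThan_add
            sum_distrib_left mult.assoc)
    qed (use N in \<open>auto simp: dilate_def Let_def\<close>)
    have "(?t * l2_norm (N *\<^sub>v v))\<^sup>2 = (l2_norm (dilate c N *\<^sub>v (0\<^sub>v n @\<^sub>v v)))\<^sup>2"
      unfolding eq l2_norm_append_vec l2_norm_smult
      by (simp add: power_mult_distrib algebra_simps)
    then have "?t * l2_norm (N *\<^sub>v v) = l2_norm (dilate c N *\<^sub>v (0\<^sub>v n @\<^sub>v v))"
      by (rule power2_eq_imp_eq) (simp_all add: l2_norm_nonneg)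
    also have "\<dots> \<le> opnorm (dilate c N) * l2_norm (0\<^sub>v n @\<^sub>v v)"
      using v by (intro l2_norm_mult_mat_vec_le[OF dilate_carrier[OF N]]) auto
    also have "(l2_norm (0\<^sub>v n @\<^sub>v v))\<^sup>2 = (l2_norm v)\<^sup>2"
      unfolding l2_norm_append_vec by (simp add: l2_norm_def L2_set_def)
    then have "l2_norm (0\<^sub>v n @\<^sub>v v) = l2_norm v"
      by (rule power2_eq_imp_eq) (simp_all add: l2_norm_nonneg)
    finally show "l2_norm (N *\<^sub>v v) \<le> opnorm (dilate c N) / ?t * l2_norm v"
      using t by (simp add: field_simps)
  qed (use t opnorm_nonneg in simp)
  then show ?thesis
    using t by (simp add: field_simps)
qed

lemma sum_blocks:
  fixes g :: "nat \<Rightarrow> 'a :: comm_monoid_add"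
  shows "(\<Sum>q<r * n. g q) = (\<Sum>l<r. \<Sum>j<n. g (l * n + j))"
proof -
  have "sum g {l * n..<l * n + n} = (\<Sum>j<n. g (l * n + j))" for l
    using sum.shift_bounds_nat_ivl[of g 0 "l * n" n] by (simp add: atLeast0LessThan add.commute)
  then show ?thesis
    by (simp add: sum.nat_group[symmetric])
qed

lemma sum_double_blocks:
  fixes g :: "nat \<Rightarrow> 'a :: comm_monoid_add"
  shows "(\<Sum>q<r * (n + n). g q) =
    (\<Sum>l<r. (\<Sum>j<n. g (l * (n + n) + j)) + (\<Sum>j<n. g (l * (n + n) + (n + j))))"
  by (simp add: sum_blocks sum_lessThan_add)

lemma block_index_less:
  fixes k i m s :: nat
  assumes "k < s" "i < m"
  shows "k * m + i < s * m"
proof -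
  have "k * m + i < Suc k * m"
    using assms by simp
  also have "\<dots> \<le> s * m"
    using assms by (intro mult_le_mono1) simp
  finally show ?thesis .
qed

lemma free_mat_eval_carrier:
  "\<delta> \<in> carrier_mat s r \<Longrightarrow> free_mat_eval \<delta> (n, x) \<in> carrier_mat (s * n) (r * n)"
  by (auto simp: free_mat_eval_def Let_def)

lemma free_mat_eval_index:
  assumes "\<delta> \<in> carrier_mat s r" "k < s" "i < n" "l < r" "j < n"
  shows "free_mat_eval \<delta> (n, x) $$ (k * n + i, l * n + j) = free_poly_eval (\<delta> $$ (k, l)) (n, x) $$ (i, j)"
  using assms block_index_less[of k s i n] block_index_less[of l r j n]
  by (simp add: free_mat_eval_def Let_def)

lemma free_mat_eval_mult_vec:
  assumes \<delta>: "\<delta> \<in> carrier_mat s r" and v: "v \<in> carrier_vec (r * n)" and k: "k < s" and i: "i < n"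
  shows "(free_mat_eval \<delta> (n, x) *\<^sub>v v) $ (k * n + i) =
    (\<Sum>l<r. \<Sum>j<n. free_poly_eval (\<delta> $$ (k, l)) (n, x) $$ (i, j) * v $ (l * n + j))"
proof -
  have "(free_mat_eval \<delta> (n, x) *\<^sub>v v) $ (k * n + i) =
      (\<Sum>q<r * n. free_mat_eval \<delta> (n, x) $$ (k * n + i, q) * v $ q)"
    using free_mat_eval_carrier[OF \<delta>, of n x] v block_index_less[OF k i]
    by (simp add: scalar_prod_def atLeast0LessThan)
  also have "\<dots> = (\<Sum>l<r. \<Sum>j<n. free_mat_eval \<delta> (n, x) $$ (k * n + i, l * n + j) * v $ (l * n + j))"
    by (rule sum_blocks)
  also have "\<dots> = (\<Sum>l<r. \<Sum>j<n. free_poly_eval (\<delta> $$ (k, l)) (n, x) $$ (i, j) * v $ (l * n + j))"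
    using free_mat_eval_index[OF \<delta> k i] by simp
  finally show ?thesis .
qed

lemma dilate_point:
  assumes x: "(n, x) \<in> nc_space d"
  shows "(n + n, map (dilate c) x) \<in> nc_space d"
    and "i < d \<Longrightarrow> scalar_column c 1 n * x ! i = map (dilate c) x ! i * scalar_column c 1 n"
    and "i < d \<Longrightarrow> scalar_column 1 0 n * snd (zero_point d n) ! i = map (dilate c) x ! i * scalar_column 1 0 n"
proof -
  have x': "n \<ge> 1" "length x = d" "set x \<subseteq> carrier_mat n n"
    using x by (auto simp: nc_space_def mat_tuples_def)
  then show "(n + n, map (dilate c) x) \<in> nc_space d"
    by (auto simp: nc_space_def mat_tuples_def intro!: dilate_carrier)
  assume i: "i < d"
  then have "x ! i \<in> carrier_mat n n"
    using x' by auto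
  with dilate_intertwine[of "x ! i" n c] i x'
  show "scalar_column c 1 n * x ! i = map (dilate c) x ! i * scalar_column c 1 n"
    and "scalar_column 1 0 n * snd (zero_point d n) ! i = map (dilate c) x ! i * scalar_column 1 0 n"
    by (simp_all add: zero_point_def)
qed

lemma zero_point_nc_space: "n \<ge> 1 \<Longrightarrow> zero_point d n \<in> nc_space d"
  by (auto simp: zero_point_def nc_space_def mat_tuples_def)

lemma free_poly_eval_dilate:
  assumes x: "(n, x) \<in> nc_space d" and p: "p \<in> free_polys d"
    and p0: "free_poly_eval p (zero_point d n) = 0\<^sub>m n n"
  shows "free_poly_eval p (n + n, map (dilate c) x) = dilate c (free_poly_eval p (n, x))"
proof (rule eq_dilate_if_intertwine)
  note y = dilate_point[OF x, where c = c]
  have "n \<ge> 1"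
    using x by (auto simp: nc_space_def)
  then have z: "(n, snd (zero_point d n)) \<in> nc_space d"
    using zero_point_nc_space[of n d] by (simp add: zero_point_def)
  show "scalar_column 1 0 n * 0\<^sub>m n n = free_poly_eval p (n + n, map (dilate c) x) * scalar_column 1 0 n"
    using free_poly_eval_intertwine[OF z y(1) scalar_column_carrier y(3) p] p0
    by (simp add: zero_point_def)
  show "scalar_column c 1 n * free_poly_eval p (n, x) =
      free_poly_eval p (n + n, map (dilate c) x) * scalar_column c 1 n"
    by (rule free_poly_eval_intertwine[OF x y(1) scalar_column_carrier y(2) p])
qed (rule free_poly_eval_carrier)+

lemma opnorm_free_mat_eval_dilate_le:
  assumes \<delta>: "\<delta> \<in> carrier_mat s r" and elem: "elements_mat \<delta> \<subseteq> free_polys d"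
    and x: "(n, x) \<in> nc_space d"
    and zero: "free_mat_eval \<delta> (zero_point d n) = 0\<^sub>m (s * n) (r * n)"
  shows "opnorm (free_mat_eval \<delta> (n + n, map (dilate c) x)) \<le>
    sqrt (1 + (cmod c)\<^sup>2) * opnorm (free_mat_eval \<delta> (n, x))"
proof (rule opnorm_leI[OF free_mat_eval_carrier[OF \<delta>]])
  let ?X = "free_mat_eval \<delta> (n, x)" and ?Y = "free_mat_eval \<delta> (n + n, map (dilate c) x)"
  let ?p = "\<lambda>k l. free_poly_eval (\<delta> $$ (k, l)) (n, x)"
  show "0 \<le> sqrt (1 + (cmod c)\<^sup>2) * opnorm ?X"
    by (simp add: opnorm_nonneg)
  have zp: "zero_point d n = (n, snd (zero_point d n))"
    by (simp add: zero_point_def)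
  have block: "free_poly_eval (\<delta> $$ (k, l)) (n + n, map (dilate c) x) = dilate c (?p k l)"
    if kl: "k < s" "l < r" for k l
  proof (rule free_poly_eval_dilate[OF x])
    show "\<delta> $$ (k, l) \<in> free_polys d"
      using elem elements_matI[OF \<delta> kl refl] by blast
    show "free_poly_eval (\<delta> $$ (k, l)) (zero_point d n) = 0\<^sub>m n n"
    proof (rule eq_matI)
      fix i j assume "i < dim_row (0\<^sub>m n n :: complex mat)" "j < dim_col (0\<^sub>m n n :: complex mat)"
      then show "free_poly_eval (\<delta> $$ (k, l)) (zero_point d n) $$ (i, j) = 0\<^sub>m n n $$ (i, j)"
        using free_mat_eval_index[OF \<delta> kl(1) _ kl(2), of i n j "snd (zero_point d n)"]
          zero block_index_less[OF kl(1)] block_index_less[OF kl(2)]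
        by (simp add: zp[symmetric])
    qed (simp_all add: free_poly_eval_def zero_point_def)
  qed
  fix v :: "complex vec" assume v: "v \<in> carrier_vec (r * (n + n))"
  define w where "w = vec (r * n) (\<lambda>q. v $ (q div n * (n + n) + (n + q mod n)))"
  have w: "w \<in> carrier_vec (r * n)"
    by (simp add: w_def)
  have w_index: "w $ (l * n + j) = v $ (l * (n + n) + (n + j))" if "l < r" "j < n" for l j
    using that block_index_less[OF that] by (simp add: w_def)
  let ?u = "?X *\<^sub>v w"
  have upper: "(?Y *\<^sub>v v) $ (k * (n + n) + i) = c * ?u $ (k * n + i)" if "k < s" "i < n" for k i
    unfolding free_mat_eval_mult_vec[OF \<delta> w that]
      free_mat_eval_mult_vec[OF \<delta> v that(1) trans_less_add1[OF that(2)]]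
    using that
    by (simp add: block dilate_index[OF free_poly_eval_carrier] sum_lessThan_add w_index
        sum_distrib_left mult.assoc)
  have lower: "(?Y *\<^sub>v v) $ (k * (n + n) + (n + i)) = ?u $ (k * n + i)" if "k < s" "i < n" for k i
    unfolding free_mat_eval_mult_vec[OF \<delta> w that]
      free_mat_eval_mult_vec[OF \<delta> v that(1) nat_add_left_cancel_less[THEN iffD2, OF that(2)]]
    using that
    by (simp add: block dilate_index[OF free_poly_eval_carrier] sum_lessThan_add w_index)
  have dims: "dim_vec (?Y *\<^sub>v v) = s * (n + n)" "dim_vec ?u = s * n"
    using free_mat_eval_carrier[OF \<delta>] by auto
  have "(l2_norm (?Y *\<^sub>v v))\<^sup>2 =
      (\<Sum>k<s. (\<Sum>i<n. (cmod c)\<^sup>2 * (cmod (?u $ (k * n + i)))\<^sup>2) + (\<Sum>i<n. (cmod (?u $ (k * n + i)))\<^sup>2))"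
    unfolding l2_norm_sq dims sum_double_blocks
    by (intro sum.cong arg_cong2[of _ _ _ _ "(+)"] refl)
      (simp_all only: lessThan_iff upper lower norm_mult power_mult_distrib)
  also have "\<dots> = (1 + (cmod c)\<^sup>2) * (l2_norm ?u)\<^sup>2"
    unfolding l2_norm_sq[of ?u] dims sum_blocks
    by (simp only: sum.distrib distrib_right sum_distrib_left mult_1_left add.commute)
  also have "\<dots> \<le> (1 + (cmod c)\<^sup>2) * (opnorm ?X * l2_norm w)\<^sup>2"
    using l2_norm_mult_mat_vec_le[OF free_mat_eval_carrier[OF \<delta>] w]
    by (intro mult_left_mono power_mono) (auto simp: l2_norm_nonneg)
  also have "\<dots> = (1 + (cmod c)\<^sup>2) * (opnorm ?X)\<^sup>2 * (l2_norm w)\<^sup>2"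
    by (simp add: power_mult_distrib)
  also have "(l2_norm w)\<^sup>2 \<le> (l2_norm v)\<^sup>2"
  proof -
    have "dim_vec w = r * n" "dim_vec v = r * (n + n)"
      using v w by auto
    then show ?thesis
      by (simp only: l2_norm_sq sum_double_blocks) (simp add: sum_blocks w_index sum.distrib sum_nonneg)
  qed
  then have "(1 + (cmod c)\<^sup>2) * (opnorm ?X)\<^sup>2 * (l2_norm w)\<^sup>2 \<le>
      (sqrt (1 + (cmod c)\<^sup>2) * opnorm ?X * l2_norm v)\<^sup>2"
    by (simp add: power_mult_distrib mult_left_mono)
  finally show "l2_norm (?Y *\<^sub>v v) \<le> sqrt (1 + (cmod c)\<^sup>2) * opnorm ?X * l2_norm v"
    by (rule power2_le_imp_le) (simp add: opnorm_nonneg l2_norm_nonneg)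
qed


section \<open>The nc Schwarz lemma\<close>

lemma nc_function_carrier:
  "nc_function d \<Omega> f \<Longrightarrow> x \<in> \<Omega> \<Longrightarrow> f x \<in> carrier_mat (fst x) (fst x)"
  by (auto simp: nc_function_def)

lemma nc_function_intertwine:
  assumes "nc_function d \<Omega> f" "x \<in> \<Omega>" "y \<in> \<Omega>" "\<alpha> \<in> carrier_mat (fst y) (fst x)"
    and "\<And>i. i < d \<Longrightarrow> \<alpha> * snd x ! i = snd y ! i * \<alpha>"
  shows "\<alpha> * f x = f y * \<alpha>"
  using assms unfolding nc_function_def by blast

lemma zero_point_B_set:
  assumes "n \<ge> 1" "free_mat_eval \<delta> (zero_point d n) = 0\<^sub>m (s * n) (r * n)"
  shows "zero_point d n \<in> B_set d \<delta>"
  using assms zero_point_nc_space by (simp add: B_set_def)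

lemma RSA_opnorm_le:
  assumes \<delta>: "\<delta> \<in> carrier_mat s r" and elem: "elements_mat \<delta> \<subseteq> free_polys d"
    and zero: "\<And>n. n \<ge> 1 \<Longrightarrow> free_mat_eval \<delta> (zero_point d n) = 0\<^sub>m (s * n) (r * n)"
    and f: "f \<in> RSA d \<delta>" and p: "p \<in> B_set d \<delta>"
  shows "opnorm (f p) \<le> opnorm (free_mat_eval \<delta> p)"
proof (rule dense_ge)
  obtain n x where p_eq: "p = (n, x)"
    by (cases p)
  have x: "(n, x) \<in> nc_space d" and n: "n \<ge> 1"
    using p by (auto simp: p_eq B_set_def nc_space_def)
  have nc: "nc_function d (B_set d \<delta>) f" and le1: "\<And>y. y \<in> B_set d \<delta> \<Longrightarrow> opnorm (f y) \<le> 1"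
    and f0: "f (zero_point d n) = 0\<^sub>m n n"
    using f n by (auto simp: RSA_def)
  let ?D = "opnorm (free_mat_eval \<delta> (n, x))"
  fix t assume "opnorm (free_mat_eval \<delta> p) < t"
  then have t: "?D < t"
    by (simp add: p_eq)
  have t0: "0 < t"
    using t opnorm_nonneg le_less_trans by blast
  show "opnorm (f p) \<le> t"
  proof (cases "t < 1")
    case False
    then show ?thesis
      using le1[OF p] by simp
  next
    case True
    define c where "c = complex_of_real (sqrt (1 / t\<^sup>2 - 1))"
    have "t\<^sup>2 \<le> 1"
      using t0 True by (simp add: power_le_one)
    then have "(cmod c)\<^sup>2 = 1 / t\<^sup>2 - 1"
      using t0 by (simp add: c_def)
    then have c: "sqrt (1 + (cmod c)\<^sup>2) = 1 / t"
      using t0 by (simp add: real_sqrt_divide)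
    let ?y = "(n + n, map (dilate c) x)"
    note y = dilate_point[OF x, where c = c]
    have "opnorm (free_mat_eval \<delta> ?y) \<le> 1 / t * ?D"
      using opnorm_free_mat_eval_dilate_le[OF \<delta> elem x zero[OF n], of c] by (simp only: c)
    also have "\<dots> < 1"
      using t t0 by simp
    finally have yB: "?y \<in> B_set d \<delta>"
      using y(1) by (simp add: B_set_def)
    have fx: "f (n, x) \<in> carrier_mat n n"
      using nc_function_carrier[OF nc p] by (simp add: p_eq)
    have "f ?y = dilate c (f (n, x))"
    proof (rule eq_dilate_if_intertwine[OF _ fx])
      show "f ?y \<in> carrier_mat (n + n) (n + n)"
        using nc_function_carrier[OF nc yB] by simp
      show "scalar_column 1 0 n * 0\<^sub>m n n = f ?y * scalar_column 1 0 n"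
        using nc_function_intertwine[OF nc zero_point_B_set[OF n zero[OF n]] yB, of "scalar_column 1 0 n"]
          y(3) scalar_column_carrier[of 1 0 n]
        by (simp add: f0) (simp add: zero_point_def)
      show "scalar_column c 1 n * f (n, x) = f ?y * scalar_column c 1 n"
        using nc_function_intertwine[OF nc p yB, of "scalar_column c 1 n"]
          y(2) scalar_column_carrier[of c 1 n]
        by (simp add: p_eq)
    qed
    then have "1 / t * opnorm (f (n, x)) \<le> 1"
      using opnorm_le_opnorm_dilate[OF fx, of c] le1[OF yB] by (simp add: c)
    then show ?thesis
      using t0 by (simp add: p_eq field_simps)
  qed
qed


section \<open>Bounds for the Cayley transforms\<close>

lemma one_minus_mat_bounded_below:
  assumes F: "F \<in> carrier_mat n n" and v: "v \<in> carrier_vec n"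
  shows "(1 - opnorm F) * l2_norm v \<le> l2_norm ((1\<^sub>m n - F) *\<^sub>v v)"
proof -
  have Fv: "F *\<^sub>v v \<in> carrier_vec n"
    by (rule mult_mat_vec_carrier[OF F v])
  have "v = (v - F *\<^sub>v v) + F *\<^sub>v v"
    using F v by (intro eq_vecI) auto
  then have "l2_norm v \<le> l2_norm (v - F *\<^sub>v v) + l2_norm (F *\<^sub>v v)"
    using l2_norm_add[of "v - F *\<^sub>v v" n "F *\<^sub>v v"] v Fv by simp
  also have "v - F *\<^sub>v v = (1\<^sub>m n - F) *\<^sub>v v"
    using F v by (simp add: minus_mult_distrib_mat_vec[of _ n n])
  finally show ?thesis
    using l2_norm_mult_mat_vec_le[OF F v] by (simp add: algebra_simps)
qed

lemma plus_one_mat_bounded_below: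
  assumes H: "H \<in> carrier_mat n n" and psd: "psd_mat (Re_mat H)" and v: "v \<in> carrier_vec n"
  shows "l2_norm v \<le> l2_norm ((H + 1\<^sub>m n) *\<^sub>v v)"
proof (rule power2_le_imp_le)
  have "(H + 1\<^sub>m n) *\<^sub>v v = H *\<^sub>v v + v"
    using H v by (simp add: add_mult_distrib_mat_vec[of _ n n])
  then have "(l2_norm ((H + 1\<^sub>m n) *\<^sub>v v))\<^sup>2 =
      (l2_norm (H *\<^sub>v v))\<^sup>2 + (l2_norm v)\<^sup>2 + 2 * Re ((H *\<^sub>v v) \<bullet>c v)"
    using H v l2_norm_sq_add[of "H *\<^sub>v v" n v] by simp
  moreover have "0 \<le> Re ((H *\<^sub>v v) \<bullet>c v)"
    using psd v by (simp add: psd_Re_mat_iff[OF H])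
  ultimately show "(l2_norm v)\<^sup>2 \<le> (l2_norm ((H + 1\<^sub>m n) *\<^sub>v v))\<^sup>2"
    by simp
qed (rule l2_norm_nonneg)

lemma psd_Re_cayley_mat:
  assumes F: "F \<in> carrier_mat n n" and inv: "invertible_mat (1\<^sub>m n - F)" and le: "opnorm F \<le> 1"
  shows "psd_mat (Re_mat ((1\<^sub>m n + F) * mat_inv (1\<^sub>m n - F)))"
proof -
  let ?G = "1\<^sub>m n - F"
  have G: "?G \<in> carrier_mat n n" and G': "1\<^sub>m n + F \<in> carrier_mat n n"
    using F by auto
  note R = mat_inv[OF G inv]
  have "0 \<le> Re ((((1\<^sub>m n + F) * mat_inv ?G) *\<^sub>v v) \<bullet>c v)" if v: "v \<in> carrier_vec n" for v
  proof -
    define w where "w = mat_inv ?G *\<^sub>v v"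
    have w: "w \<in> carrier_vec n"
      using R(1) v by (simp add: w_def)
    have "?G *\<^sub>v w = v"
      unfolding w_def using R(2) v by (simp flip: assoc_mult_mat_vec[OF G R(1) v])
    then have v_eq: "v = w - F *\<^sub>v w"
      using F w by (simp add: minus_mult_distrib_mat_vec[of _ n n])
    have "((1\<^sub>m n + F) * mat_inv ?G) *\<^sub>v v = (1\<^sub>m n + F) *\<^sub>v w"
      unfolding w_def by (rule assoc_mult_mat_vec[OF G' R(1) v])
    also have "\<dots> = w + F *\<^sub>v w"
      using F w by (simp add: add_mult_distrib_mat_vec[of _ n n])
    finally have "Re ((((1\<^sub>m n + F) * mat_inv ?G) *\<^sub>v v) \<bullet>c v) = (l2_norm w)\<^sup>2 - (l2_norm (F *\<^sub>v w))\<^sup>2"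
      using v_eq Re_scalar_prod_add_minus[of w n "F *\<^sub>v w"] F w by simp
    moreover have "l2_norm (F *\<^sub>v w) \<le> 1 * l2_norm w"
      using l2_norm_mult_mat_vec_le[OF F w] le l2_norm_nonneg[of w]
      by (meson mult_right_mono order_trans)
    ultimately show ?thesis
      using power_mono[of "l2_norm (F *\<^sub>v w)" "l2_norm w" 2] l2_norm_nonneg by simp
  qed
  then show ?thesis
    using psd_Re_mat_iff[OF mult_carrier_mat[OF G' R(1)]] by blast
qed

lemma opnorm_inv_cayley_mat_le:
  assumes H: "H \<in> carrier_mat n n" and inv: "invertible_mat (H + 1\<^sub>m n)" and psd: "psd_mat (Re_mat H)"
  shows "opnorm ((H - 1\<^sub>m n) * mat_inv (H + 1\<^sub>m n)) \<le> 1"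
proof -
  let ?G = "H + 1\<^sub>m n"
  have G: "?G \<in> carrier_mat n n" and G': "H - 1\<^sub>m n \<in> carrier_mat n n"
    using H by auto
  note R = mat_inv[OF G inv]
  show ?thesis
  proof (rule opnorm_leI[OF mult_carrier_mat[OF G' R(1)]])
    fix v :: "complex vec" assume v: "v \<in> carrier_vec n"
    define w where "w = mat_inv ?G *\<^sub>v v"
    have w: "w \<in> carrier_vec n"
      using R(1) v by (simp add: w_def)
    have "?G *\<^sub>v w = v"
      unfolding w_def using R(2) v by (simp flip: assoc_mult_mat_vec[OF G R(1) v])
    then have v_eq: "v = H *\<^sub>v w + w"
      using H w by (simp add: add_mult_distrib_mat_vec[of _ n n])
    have "((H - 1\<^sub>m n) * mat_inv ?G) *\<^sub>v v = (H - 1\<^sub>m n) *\<^sub>v w"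
      unfolding w_def by (rule assoc_mult_mat_vec[OF G' R(1) v])
    also have "\<dots> = H *\<^sub>v w - w"
      using H w by (simp add: minus_mult_distrib_mat_vec[of _ n n])
    finally have eq: "((H - 1\<^sub>m n) * mat_inv ?G) *\<^sub>v v = H *\<^sub>v w - w" .
    have "0 \<le> Re ((H *\<^sub>v w) \<bullet>c w)"
      using psd w by (simp add: psd_Re_mat_iff[OF H])
    then have "(l2_norm (H *\<^sub>v w - w))\<^sup>2 \<le> (l2_norm v)\<^sup>2"
      unfolding v_eq using l2_norm_sq_add[of "H *\<^sub>v w" n w] l2_norm_sq_minus[of "H *\<^sub>v w" n w] H w
      by simp
    then have "l2_norm (H *\<^sub>v w - w) \<le> l2_norm v"
      by (rule power2_le_imp_le) (rule l2_norm_nonneg)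
    then show "l2_norm (((H - 1\<^sub>m n) * mat_inv ?G) *\<^sub>v v) \<le> 1 * l2_norm v"
      unfolding eq by simp
  qed simp
qed

lemma opnorm_smult_mat_inv_diff_le:
  assumes A: "A \<in> carrier_mat n n" "invertible_mat A" "opnorm (mat_inv A) \<le> K"
    and B: "B \<in> carrier_mat n n" "invertible_mat B" "opnorm (mat_inv B) \<le> K"
  shows "opnorm (2 \<cdot>\<^sub>m (mat_inv A - mat_inv B)) \<le> 2 * K\<^sup>2 * opnorm (B - A)"
proof -
  note A' = mat_inv[OF A(1,2)] and B' = mat_inv[OF B(1,2)]
  have BA: "B - A \<in> carrier_mat n n"
    using A(1) by auto
  have K: "0 \<le> K"
    using opnorm_nonneg A(3) order_trans by blast
  have "opnorm (2 \<cdot>\<^sub>m (mat_inv A - mat_inv B)) \<le> 2 * opnorm (mat_inv A - mat_inv B)"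
    using opnorm_smult_le[OF minus_carrier_mat[OF B'(1)], of 2 "mat_inv A"] by simp
  also have "opnorm (mat_inv A - mat_inv B) \<le> opnorm (mat_inv A * (B - A)) * opnorm (mat_inv B)"
    unfolding mat_inv_diff[OF A(1,2) B(1,2)]
    by (rule opnorm_mult_le[OF mult_carrier_mat[OF A'(1) BA] B'(1)])
  also have "\<dots> \<le> (K * opnorm (B - A)) * K"
  proof (intro mult_mono order_trans[OF opnorm_mult_le[OF A'(1) BA]])
    show "opnorm (mat_inv A) \<le> K" "opnorm (mat_inv B) \<le> K"
      by (fact A B)+
  qed (use K opnorm_nonneg in auto)
  finally show ?thesis
    by (simp add: power2_eq_square ac_simps)
qed

lemma opnorm_cayley_mat_diff_le:
  assumes F: "F \<in> carrier_mat n n" "opnorm F \<le> \<rho>" and G: "G \<in> carrier_mat n n" "opnorm G \<le> \<rho>"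
    and \<rho>: "\<rho> < 1"
  shows "opnorm ((1\<^sub>m n + G) * mat_inv (1\<^sub>m n - G) - (1\<^sub>m n + F) * mat_inv (1\<^sub>m n - F)) \<le>
    2 * (1 / (1 - \<rho>))\<^sup>2 * opnorm (G - F)"
proof -
  let ?A = "1\<^sub>m n - G" and ?B = "1\<^sub>m n - F"
  have bound: "invertible_mat (1\<^sub>m n - E)" "opnorm (mat_inv (1\<^sub>m n - E)) \<le> 1 / (1 - \<rho>)"
    if E: "E \<in> carrier_mat n n" "opnorm E \<le> \<rho>" for E
  proof -
    have "(1 - \<rho>) * l2_norm v \<le> l2_norm ((1\<^sub>m n - E) *\<^sub>v v)" if v: "v \<in> carrier_vec n" for v
      using one_minus_mat_bounded_below[OF E(1) v] E(2) l2_norm_nonneg[of v]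
      by (meson diff_left_mono mult_right_mono order_trans)
    then show "invertible_mat (1\<^sub>m n - E)" "opnorm (mat_inv (1\<^sub>m n - E)) \<le> 1 / (1 - \<rho>)"
      using \<rho> invertible_mat_if_bounded_below[OF minus_carrier_mat[OF E(1)], of "1 - \<rho>"]
        opnorm_mat_inv_le[OF minus_carrier_mat[OF E(1)], of "1 - \<rho>"] by auto
  qed
  have A: "?A \<in> carrier_mat n n" and B: "?B \<in> carrier_mat n n"
    using F G by auto
  note invs = bound(1)[OF G] bound(1)[OF F]
  note R = mat_inv(1)[OF A invs(1)] mat_inv(1)[OF B invs(2)]
  have "(1\<^sub>m n + G) * mat_inv ?A - (1\<^sub>m n + F) * mat_inv ?B = 2 \<cdot>\<^sub>m (mat_inv ?A - mat_inv ?B)"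
    unfolding cayley_mat_eq[OF G(1) invs(1)] cayley_mat_eq[OF F(1) invs(2)]
    using R by (intro eq_matI) (auto simp: algebra_simps)
  moreover have "?B - ?A = G - F"
    using F G by (intro eq_matI) auto
  ultimately show ?thesis
    using opnorm_smult_mat_inv_diff_le[OF A invs(1) bound(2)[OF G] B invs(2) bound(2)[OF F]] by simp
qed

lemma opnorm_inv_cayley_mat_diff_le:
  assumes H: "H \<in> carrier_mat n n" "psd_mat (Re_mat H)" and G: "G \<in> carrier_mat n n" "psd_mat (Re_mat G)"
  shows "opnorm ((G - 1\<^sub>m n) * mat_inv (G + 1\<^sub>m n) - (H - 1\<^sub>m n) * mat_inv (H + 1\<^sub>m n)) \<le>
    2 * opnorm (G - H)"
proof -
  let ?A = "G + 1\<^sub>m n" and ?B = "H + 1\<^sub>m n"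
  have bound: "invertible_mat (E + 1\<^sub>m n)" "opnorm (mat_inv (E + 1\<^sub>m n)) \<le> 1"
    if E: "E \<in> carrier_mat n n" "psd_mat (Re_mat E)" for E
    using E plus_one_mat_bounded_below[OF E] invertible_mat_if_bounded_below[of "E + 1\<^sub>m n" n 1]
      opnorm_mat_inv_le[of "E + 1\<^sub>m n" n 1] by auto
  have A: "?A \<in> carrier_mat n n" and B: "?B \<in> carrier_mat n n"
    using H G by auto
  note invs = bound(1)[OF G] bound(1)[OF H]
  note R = mat_inv(1)[OF A invs(1)] mat_inv(1)[OF B invs(2)]
  have "(G - 1\<^sub>m n) * mat_inv ?A - (H - 1\<^sub>m n) * mat_inv ?B = 2 \<cdot>\<^sub>m (mat_inv ?B - mat_inv ?A)"
    unfolding inv_cayley_mat_eq[OF G(1) invs(1)] inv_cayley_mat_eq[OF H(1) invs(2)]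
    using R by (intro eq_matI) (auto simp: algebra_simps)
  moreover have "?A - ?B = G - H"
    using H G by (intro eq_matI) auto
  ultimately show ?thesis
    using opnorm_smult_mat_inv_diff_le[OF B invs(2) bound(2)[OF H] A invs(1) bound(2)[OF G]] by simp
qed


section \<open>The two classes\<close>

lemma mult_intertwine:
  assumes "A \<in> carrier_mat n n" "A' \<in> carrier_mat n n" "B \<in> carrier_mat m m" "B' \<in> carrier_mat m m"
    and \<alpha>: "\<alpha> \<in> carrier_mat m n" and "\<alpha> * A = B * \<alpha>" "\<alpha> * A' = B' * \<alpha>"
  shows "\<alpha> * (A * A') = B * B' * \<alpha>"
proof -
  have "\<alpha> * (A * A') = \<alpha> * A * A'"
    by (rule assoc_mult_mat[symmetric, OF \<alpha> assms(1,2)])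
  also have "\<dots> = B * (\<alpha> * A')"
    unfolding assms(6) by (rule assoc_mult_mat[OF assms(3) \<alpha> assms(2)])
  also have "\<dots> = B * B' * \<alpha>"
    unfolding assms(7) by (rule assoc_mult_mat[symmetric, OF assms(3,4) \<alpha>])
  finally show ?thesis .
qed

lemma plus_minus_one_intertwine:
  fixes F G \<alpha> :: "complex mat"
  assumes F: "F \<in> carrier_mat n n" and G: "G \<in> carrier_mat m m" and \<alpha>: "\<alpha> \<in> carrier_mat m n"
    and eq: "\<alpha> * F = G * \<alpha>"
  shows "\<alpha> * (1\<^sub>m n + F) = (1\<^sub>m m + G) * \<alpha>" "\<alpha> * (1\<^sub>m n - F) = (1\<^sub>m m - G) * \<alpha>"
    "\<alpha> * (F + 1\<^sub>m n) = (G + 1\<^sub>m m) * \<alpha>" "\<alpha> * (F - 1\<^sub>m n) = (G - 1\<^sub>m m) * \<alpha>"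
  using \<alpha> eq
    mult_add_distrib_mat[OF \<alpha> one_carrier_mat F] add_mult_distrib_mat[OF one_carrier_mat G \<alpha>]
    mult_minus_distrib_mat[OF \<alpha> one_carrier_mat F] minus_mult_distrib_mat[OF one_carrier_mat G \<alpha>]
    mult_add_distrib_mat[OF \<alpha> F one_carrier_mat] add_mult_distrib_mat[OF G one_carrier_mat \<alpha>]
    mult_minus_distrib_mat[OF \<alpha> F one_carrier_mat] minus_mult_distrib_mat[OF G one_carrier_mat \<alpha>]
  by simp_all

lemma nc_function_cayley:
  assumes f: "nc_function d (B_set d \<delta>) f"
    and inv: "\<And>x. x \<in> B_set d \<delta> \<Longrightarrow> invertible_mat (1\<^sub>m (fst x) - f x)"
  shows "nc_function d (B_set d \<delta>) (cayley d \<delta> f)"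
proof -
  have fx: "f x \<in> carrier_mat (fst x) (fst x)" if "x \<in> B_set d \<delta>" for x
    using nc_function_carrier[OF f that] .
  have P: "1\<^sub>m (fst x) + f x \<in> carrier_mat (fst x) (fst x)"
    and M: "1\<^sub>m (fst x) - f x \<in> carrier_mat (fst x) (fst x)" if "x \<in> B_set d \<delta>" for x
    using fx[OF that] by auto
  note R = mat_inv(1)[OF M inv]
  show ?thesis
    unfolding nc_function_def
  proof (intro conjI ballI impI)
    show "cayley d \<delta> f \<in> (\<Pi>\<^sub>E x\<in>B_set d \<delta>. carrier_mat (fst x) (fst x))"
      using mult_carrier_mat[OF P R] by (auto simp: cayley_def)
    fix x y \<alpha>
    assume x: "x \<in> B_set d \<delta>" and y: "y \<in> B_set d \<delta>" and \<alpha>: "\<alpha> \<in> carrier_mat (fst y) (fst x)"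
      and eq: "\<forall>i<d. \<alpha> * snd x ! i = snd y ! i * \<alpha>"
    have "\<alpha> * f x = f y * \<alpha>"
      using nc_function_intertwine[OF f x y \<alpha>] eq by blast
    note eqs = plus_minus_one_intertwine[OF fx[OF x] fx[OF y] \<alpha> this]
    show "\<alpha> * cayley d \<delta> f x = cayley d \<delta> f y * \<alpha>"
      unfolding cayley_def restrict_apply'[OF x] restrict_apply'[OF y]
      using mult_intertwine[OF P[OF x] R[OF x x] P[OF y] R[OF y y] \<alpha> eqs(1)
          mat_inv_intertwine[OF M[OF x] inv[OF x] M[OF y] inv[OF y] \<alpha> eqs(2)]] .
  qed
qed

lemma nc_function_inv_cayley:
  assumes h: "nc_function d (B_set d \<delta>) h"
    and inv: "\<And>x. x \<in> B_set d \<delta> \<Longrightarrow> invertible_mat (h x + 1\<^sub>m (fst x))"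
  shows "nc_function d (B_set d \<delta>) (inv_cayley d \<delta> h)"
proof -
  have hx: "h x \<in> carrier_mat (fst x) (fst x)" if "x \<in> B_set d \<delta>" for x
    using nc_function_carrier[OF h that] .
  have P: "h x + 1\<^sub>m (fst x) \<in> carrier_mat (fst x) (fst x)"
    and M: "h x - 1\<^sub>m (fst x) \<in> carrier_mat (fst x) (fst x)" if "x \<in> B_set d \<delta>" for x
    using hx[OF that] by auto
  note R = mat_inv(1)[OF P inv]
  show ?thesis
    unfolding nc_function_def
  proof (intro conjI ballI impI)
    show "inv_cayley d \<delta> h \<in> (\<Pi>\<^sub>E x\<in>B_set d \<delta>. carrier_mat (fst x) (fst x))"
      using mult_carrier_mat[OF M R] by (auto simp: inv_cayley_def)
    fix x y \<alpha>
    assume x: "x \<in> B_set d \<delta>" and y: "y \<in> B_set d \<delta>" and \<alpha>: "\<alpha> \<in> carrier_mat (fst y) (fst x)"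
      and eq: "\<forall>i<d. \<alpha> * snd x ! i = snd y ! i * \<alpha>"
    have "\<alpha> * h x = h y * \<alpha>"
      using nc_function_intertwine[OF h x y \<alpha>] eq by blast
    note eqs = plus_minus_one_intertwine[OF hx[OF x] hx[OF y] \<alpha> this]
    show "\<alpha> * inv_cayley d \<delta> h x = inv_cayley d \<delta> h y * \<alpha>"
      unfolding inv_cayley_def restrict_apply'[OF x] restrict_apply'[OF y]
      using mult_intertwine[OF M[OF x] R[OF x x] M[OF y] R[OF y y] \<alpha> eqs(4)
          mat_inv_intertwine[OF P[OF x] inv[OF x] P[OF y] inv[OF y] \<alpha> eqs(3)]] .
  qed
qed

lemma continuous_map_unif_topology:
  assumes F: "F \<in> C \<rightarrow> D"
    and lip: "\<And>\<rho>. 0 < \<rho> \<Longrightarrow> \<rho> < 1 \<Longrightarrow> \<exists>L>0. \<forall>f\<in>C. \<forall>g\<in>C. \<forall>x\<in>K_set d \<delta> \<rho>.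
      opnorm (F g x - F f x) \<le> L * opnorm (g x - f x)"
  shows "continuous_map (unif_topology d \<delta> C) (unif_topology d \<delta> D) F"
  unfolding continuous_map_def topspace_unif_topology openin_unif_topology
proof (intro conjI allI impI)
  fix U assume U: "unif_open d \<delta> D U"
  show "unif_open d \<delta> C {f \<in> C. F f \<in> U}"
    unfolding unif_open_def
  proof (intro conjI ballI)
    fix f assume "f \<in> {f \<in> C. F f \<in> U}"
    then have f: "f \<in> C" "F f \<in> U"
      by auto
    then obtain \<rho> \<epsilon> where \<rho>: "0 < \<rho>" "\<rho> < 1" and \<epsilon>: "\<epsilon> > 0"
      and sub: "{g \<in> D. \<forall>x\<in>K_set d \<delta> \<rho>. opnorm (g x - F f x) < \<epsilon>} \<subseteq> U"
      using U unfolding unif_open_def by blast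
    obtain L where L: "L > 0" and le: "\<And>g x. g \<in> C \<Longrightarrow> x \<in> K_set d \<delta> \<rho> \<Longrightarrow>
        opnorm (F g x - F f x) \<le> L * opnorm (g x - f x)"
      using lip[OF \<rho>] f(1) by blast
    have "F g \<in> U" if g: "g \<in> C" and lt: "\<forall>x\<in>K_set d \<delta> \<rho>. opnorm (g x - f x) < \<epsilon> / L" for g
    proof -
      have "opnorm (F g x - F f x) < \<epsilon>" if x: "x \<in> K_set d \<delta> \<rho>" for x
      proof -
        have "L * opnorm (g x - f x) < \<epsilon>"
          using bspec[OF lt x] L by (simp add: field_simps)
        then show ?thesis
          using le[OF g x] by simp
      qed
      then show ?thesis
        using sub F g by blast
    qed
    then have "{g \<in> C. \<forall>x\<in>K_set d \<delta> \<rho>. opnorm (g x - f x) < \<epsilon> / L} \<subseteq> {f \<in> C. F f \<in> U}"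
      by blast
    then show "\<exists>\<rho>>0. \<rho> < 1 \<and> (\<exists>\<epsilon>>0.
        {g \<in> C. \<forall>x\<in>K_set d \<delta> \<rho>. opnorm (g x - f x) < \<epsilon>} \<subseteq> {f \<in> C. F f \<in> U})"
      using \<rho> divide_pos_pos[OF \<epsilon> L] by blast
  qed blast
qed (use F in auto)

theorem proposition3p8:
  fixes d s r :: nat and \<delta> :: "free_poly mat"
  assumes "\<delta> \<in> carrier_mat s r"
    and "elements_mat \<delta> \<subseteq> free_polys d"
    and "\<And>n. n \<ge> 1 \<Longrightarrow> free_mat_eval \<delta> (zero_point d n) = 0\<^sub>m (s * n) (r * n)"
  shows "(\<forall>f \<in> RSA d \<delta>. \<forall>x \<in> B_set d \<delta>. invertible_mat (1\<^sub>m (fst x) - f x)) \<and>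
    (\<forall>h \<in> RHA d \<delta>. \<forall>x \<in> B_set d \<delta>. invertible_mat (h x + 1\<^sub>m (fst x))) \<and>
    homeomorphic_maps (unif_topology d \<delta> (RSA d \<delta>)) (unif_topology d \<delta> (RHA d \<delta>))
      (cayley d \<delta>) (inv_cayley d \<delta>)"
proof -
  have schwarz: "opnorm (f x) \<le> opnorm (free_mat_eval \<delta> x)"
    if "f \<in> RSA d \<delta>" "x \<in> B_set d \<delta>" for f x
    by (rule RSA_opnorm_le[OF assms(1,2) _ that]) (rule assms(3))
  have zero_B: "zero_point d n \<in> B_set d \<delta>" if "n \<ge> 1" for n
    using zero_point_B_set[OF that assms(3)[OF that]] .
  have fst_zero: "fst (zero_point d n) = n" for n
    by (simp add: zero_point_def)
  have f_carrier: "f x \<in> carrier_mat (fst x) (fst x)" if "f \<in> RSA d \<delta>" "x \<in> B_set d \<delta>" for f x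
    using that nc_function_carrier[OF _ that(2)] by (auto simp: RSA_def)
  have h_carrier: "h x \<in> carrier_mat (fst x) (fst x)" if "h \<in> RHA d \<delta>" "x \<in> B_set d \<delta>" for h x
    using that nc_function_carrier[OF _ that(2)] by (auto simp: RHA_def)
  have psd: "psd_mat (Re_mat (h x))" if "h \<in> RHA d \<delta>" "x \<in> B_set d \<delta>" for h x
    using that by (simp add: RHA_def)
  have f_inv: "invertible_mat (1\<^sub>m (fst x) - f x)" if f: "f \<in> RSA d \<delta>" and x: "x \<in> B_set d \<delta>" for f x
  proof (rule invertible_mat_if_bounded_below)
    show "1\<^sub>m (fst x) - f x \<in> carrier_mat (fst x) (fst x)"
      using f_carrier[OF f x] by auto
    show "0 < 1 - opnorm (f x)"
      using schwarz[OF f x] x by (simp add: B_set_def)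
  qed (rule one_minus_mat_bounded_below[OF f_carrier[OF f x]])
  have h_inv: "invertible_mat (h x + 1\<^sub>m (fst x))" if h: "h \<in> RHA d \<delta>" and x: "x \<in> B_set d \<delta>" for h x
  proof (rule invertible_mat_if_bounded_below[where c = 1])
    show "h x + 1\<^sub>m (fst x) \<in> carrier_mat (fst x) (fst x)"
      using h_carrier[OF h x] by auto
  qed (use plus_one_mat_bounded_below[OF h_carrier[OF h x] psd[OF h x]] in auto)
  have one_minus_zero: "1\<^sub>m n - 0\<^sub>m n n = (1\<^sub>m n :: complex mat)" for n
    by (intro eq_matI) auto
  have one_inv: "mat_inv (1\<^sub>m n) = 1\<^sub>m n" for n
    by (rule mat_inv_unique) auto
  have cayley_RHA: "cayley d \<delta> f \<in> RHA d \<delta>" if f: "f \<in> RSA d \<delta>" for f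
    unfolding RHA_def
  proof (intro CollectI conjI ballI allI impI)
    show "nc_function d (B_set d \<delta>) (cayley d \<delta> f)"
      using f f_inv[OF f] by (intro nc_function_cayley) (auto simp: RSA_def)
    show "psd_mat (Re_mat (cayley d \<delta> f x))" if x: "x \<in> B_set d \<delta>" for x
      using psd_Re_cayley_mat[OF f_carrier[OF f x] f_inv[OF f x]] f x
      by (simp add: cayley_def RSA_def)
    show "cayley d \<delta> f (zero_point d n) = 1\<^sub>m n" if n: "n \<ge> 1" for n
      using f n zero_B[OF n] one_minus_zero[of n]
      by (simp add: cayley_def RSA_def fst_zero one_inv)
  qed
  have inv_cayley_RSA: "inv_cayley d \<delta> h \<in> RSA d \<delta>" if h: "h \<in> RHA d \<delta>" for h
    unfolding RSA_def
  proof (intro CollectI conjI ballI allI impI)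
    show "nc_function d (B_set d \<delta>) (inv_cayley d \<delta> h)"
      using h h_inv[OF h] by (intro nc_function_inv_cayley) (auto simp: RHA_def)
    show "opnorm (inv_cayley d \<delta> h x) \<le> 1" if x: "x \<in> B_set d \<delta>" for x
      using opnorm_inv_cayley_mat_le[OF h_carrier[OF h x] h_inv[OF h x] psd[OF h x]] x
      by (simp add: inv_cayley_def)
    show "inv_cayley d \<delta> h (zero_point d n) = 0\<^sub>m n n" if n: "n \<ge> 1" for n
    proof -
      have h1: "h (zero_point d n) = 1\<^sub>m n"
        using h n by (simp add: RHA_def)
      have "mat_inv (1\<^sub>m n + 1\<^sub>m n) \<in> carrier_mat n n"
        using mat_inv(1)[OF _ h_inv[OF h zero_B[OF n]], of n] by (simp add: h1 fst_zero)
      then show ?thesis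
        using zero_B[OF n] by (simp add: inv_cayley_def h1 fst_zero minus_r_inv_mat[OF one_carrier_mat])
    qed
  qed
  have inv1: "inv_cayley d \<delta> (cayley d \<delta> f) = f" if f: "f \<in> RSA d \<delta>" for f
  proof
    fix x
    show "inv_cayley d \<delta> (cayley d \<delta> f) x = f x"
    proof (cases "x \<in> B_set d \<delta>")
      case True
      then show ?thesis
        using inv_cayley_cayley_mat[OF f_carrier[OF f True] f_inv[OF f True] refl]
        by (simp add: inv_cayley_def cayley_def)
    next
      case False
      then show ?thesis
        using f by (auto simp: inv_cayley_def RSA_def nc_function_def)
    qed
  qed
  have inv2: "cayley d \<delta> (inv_cayley d \<delta> h) = h" if h: "h \<in> RHA d \<delta>" for h
  proof
    fix x
    show "cayley d \<delta> (inv_cayley d \<delta> h) x = h x"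
    proof (cases "x \<in> B_set d \<delta>")
      case True
      then show ?thesis
        using cayley_inv_cayley_mat[OF h_carrier[OF h True] h_inv[OF h True] refl]
        by (simp add: inv_cayley_def cayley_def)
    next
      case False
      then show ?thesis
        using h by (auto simp: cayley_def RHA_def nc_function_def)
    qed
  qed
  have "continuous_map (unif_topology d \<delta> (RSA d \<delta>)) (unif_topology d \<delta> (RHA d \<delta>)) (cayley d \<delta>)"
  proof (rule continuous_map_unif_topology)
    fix \<rho> :: real assume \<rho>: "0 < \<rho>" "\<rho> < 1"
    have "opnorm (cayley d \<delta> g x - cayley d \<delta> f x) \<le> 2 * (1 / (1 - \<rho>))\<^sup>2 * opnorm (g x - f x)"
      if "f \<in> RSA d \<delta>" "g \<in> RSA d \<delta>" "x \<in> K_set d \<delta> \<rho>" for f g x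
    proof -
      have x: "x \<in> B_set d \<delta>" and "opnorm (free_mat_eval \<delta> x) \<le> \<rho>"
        using that by (auto simp: K_set_def)
      then have "opnorm (f x) \<le> \<rho>" "opnorm (g x) \<le> \<rho>"
        using schwarz[OF _ x] that order_trans by blast+
      then show ?thesis
        using opnorm_cayley_mat_diff_le[of "f x" "fst x" \<rho> "g x"] f_carrier[OF _ x] that \<rho> x
        by (simp add: cayley_def)
    qed
    then show "\<exists>L>0. \<forall>f\<in>RSA d \<delta>. \<forall>g\<in>RSA d \<delta>. \<forall>x\<in>K_set d \<delta> \<rho>.
        opnorm (cayley d \<delta> g x - cayley d \<delta> f x) \<le> L * opnorm (g x - f x)"
      using \<rho> by (intro exI[of _ "2 * (1 / (1 - \<rho>))\<^sup>2"]) auto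
  qed (use cayley_RHA in blast)
  moreover have "continuous_map (unif_topology d \<delta> (RHA d \<delta>)) (unif_topology d \<delta> (RSA d \<delta>)) (inv_cayley d \<delta>)"
  proof (rule continuous_map_unif_topology)
    fix \<rho> :: real
    have "opnorm (inv_cayley d \<delta> g x - inv_cayley d \<delta> h x) \<le> 2 * opnorm (g x - h x)"
      if "h \<in> RHA d \<delta>" "g \<in> RHA d \<delta>" "x \<in> K_set d \<delta> \<rho>" for g h x
    proof -
      have x: "x \<in> B_set d \<delta>"
        using that by (simp add: K_set_def)
      then show ?thesis
        using opnorm_inv_cayley_mat_diff_le[of "h x" "fst x" "g x"] h_carrier[OF _ x] psd[OF _ x] that
        by (simp add: inv_cayley_def)
    qed
    then show "\<exists>L>0. \<forall>f\<in>RHA d \<delta>. \<forall>g\<in>RHA d \<delta>. \<forall>x\<in>K_set d \<delta> \<rho>.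
        opnorm (inv_cayley d \<delta> g x - inv_cayley d \<delta> f x) \<le> L * opnorm (g x - f x)"
      by (intro exI[of _ 2]) auto
  qed (use inv_cayley_RSA in blast)
  ultimately show ?thesis
    using f_inv h_inv inv1 inv2 by (simp add: homeomorphic_maps_def)
qed

end
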